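(* Let $\mathcal V=\{v_1,\dots,v_k\}$ be distributions over $[n]$ with $k$ a power of two, let $p$ be an unknown distribution over $[n]$, and let $\varepsilon>0$ and $\delta\ge k^{-1/4}$. Run the following algorithm. Define $\delta_i=\delta/4^i$, $s_i=\frac{10\log(1/\delta_i)}{\varepsilon^2}$, $\mathcal V_1=\mathcal V$, and $\mathcal C=\emptyset$. For $i=1,\dots,\lg k$: (1) select uniformly at random a subset of $\min\{k^{1/3},|\mathcal V_i|\}$ elements of $\mathcal V_i$ and add them to $\mathcal C$; (2) randomly partition $\mathcal V_i$ into $|\mathcal V_i|/2$ pairs and run the Scheffe test on each pair using the first $s_i$ elements of a sample of i.i.d. draws from $p$; (3) let $\mathcal V_{i+1}$ be the set of the $|\mathcal V_i|/2$ winners. Finally, draw a fresh independent sample of $\frac{10\log(\binom{|\mathcal C|}{2}/\delta)}{\varepsilon^2}$ points from $p$, run the Scheffe test with it on every pair of distributions in $\mathcal C$, and output the distribution $\hat v\in\mathcal C$ with the most wins (ties broken arbitrarily). Then with probability $1-O(\delta)$, $$\|p-\hat v\|_1\le 27\cdot\min_j\|p-v_j\|_1+O(\varepsilon).$$ The algorithm uses $s=O((\log k+\log\frac1\delta)/\varepsilon^2)$ samples from $p$ and runs in time $O\!\left(\frac{k}{\varepsilon^2}\log\frac1\delta\right)$ (given a preprocessing step in which, for every pair $(v_i,v_j)$, the total variation distance between them and the quantities $v_i(S_{ij}),v_j(S_{ij})$ below are computed and stored).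
   Context: The Scheffe test on a pair of distributions $(v_a,v_b)$ over $[n]$ with a multiset of samples from $p$: let $S=\{x\in[n]: v_a(x)>v_b(x)\}$, let $\mu_S$ be the fraction of the samples lying in $S$; output $v_a$ if $|v_a(S)-\mu_S|\le|v_b(S)-\mu_S|$ and $v_b$ otherwise (the winner). Here $v(S)=\sum_{x\in S}v(x)$. Running a Scheffe test with $s$ samples takes $O(s)$ time given the precomputed values $v_a(S),v_b(S)$. $\lg$ denotes base-2 logarithm.
   Formalization: The running-time bound (unit-cost count) is for ε ≤ ε₀, δ ≤ δ₀ < 1, with constant depending on ε₀, δ₀, and the sample bound is for δ ≤ 1, since log(1/δ) vanishes at δ = 1 and the literal bounds fail; non-integer sizes are rounded down. *)

theory Defs
  imports "HOL-Probability.Probability" "HOL-Library.Monad_Syntax"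
begin

text \<open>
  The candidates are a family \<open>v 1, \<dots>, v k\<close>; all sets of candidates below are sets of indices.
  Quantities that the algorithm uses as cardinalities or sample sizes are rounded down.
\<close>

definition selection_input ::
  "nat \<Rightarrow> nat \<Rightarrow> (nat \<Rightarrow> nat pmf) \<Rightarrow> nat pmf \<Rightarrow> real \<Rightarrow> real \<Rightarrow> bool" where
  "selection_input n k v p \<epsilon> \<delta> \<longleftrightarrow>
     (\<exists>m. k = 2 ^ m) \<and> (\<forall>j\<in>{1..k}. set_pmf (v j) \<subseteq> {1..n}) \<and> set_pmf p \<subseteq> {1..n} \<and>
     \<epsilon> > 0 \<and> \<delta> \<ge> real k powr (-1/4)"

definition l1_dist :: "nat \<Rightarrow> nat pmf \<Rightarrow> nat pmf \<Rightarrow> real" where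
  "l1_dist n p q = (\<Sum>x=1..n. \<bar>pmf p x - pmf q x\<bar>)"

text \<open>
  For distributions supported on \<open>{1..n}\<close> the Scheffe set is automatically contained in \<open>{1..n}\<close>.
  The fraction of an empty sample lying in a set is \<open>0\<close>.
\<close>

definition scheffe_set :: "nat pmf \<Rightarrow> nat pmf \<Rightarrow> nat set" where
  "scheffe_set q r = {x. pmf q x > pmf r x}"

definition sample_fraction :: "nat list \<Rightarrow> nat set \<Rightarrow> real" where
  "sample_fraction xs S = real (length (filter (\<lambda>x. x \<in> S) xs)) / real (length xs)"

definition scheffe_test :: "(nat \<Rightarrow> nat pmf) \<Rightarrow> nat list \<Rightarrow> nat \<Rightarrow> nat \<Rightarrow> nat" where
  "scheffe_test v xs a b =
     (let S = scheffe_set (v a) (v b); \<mu> = sample_fraction xs S in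
      if \<bar>measure_pmf.prob (v a) S - \<mu>\<bar> \<le> \<bar>measure_pmf.prob (v b) S - \<mu>\<bar> then a else b)"

text \<open>
  The Scheffe test is not symmetric in case of equality, so an unordered pair is tested with
  the smaller index first.
\<close>

definition pair_winner :: "(nat \<Rightarrow> nat pmf) \<Rightarrow> nat list \<Rightarrow> nat set \<Rightarrow> nat" where
  "pair_winner v xs e = scheffe_test v xs (Min e) (Max e)"

text \<open>
  Time of one test: constant time per sample point (is it in the Scheffe set?) plus constant time
  for the comparison; the two masses of the Scheffe set are looked up, having been precomputed.
\<close>

definition scheffe_time :: "nat list \<Rightarrow> nat" where
  "scheffe_time xs = length xs + 1"

definition pairings :: "nat set \<Rightarrow> nat set set set" where
  "pairings V = {P. partition_on V P \<and> (\<forall>e\<in>P. card e = 2)}"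

definition num_selected :: "nat \<Rightarrow> nat" where
  "num_selected k = nat \<lfloor>real k powr (1/3)\<rfloor>"

definition num_rounds :: "nat \<Rightarrow> nat" where
  "num_rounds k = nat \<lfloor>log 2 (real k)\<rfloor>"

definition round_size :: "real \<Rightarrow> real \<Rightarrow> nat \<Rightarrow> nat" where
  "round_size \<epsilon> \<delta> i = nat \<lfloor>10 * ln (1 / (\<delta> / 4 ^ i)) / \<epsilon>\<^sup>2\<rfloor>"

text \<open>If \<open>c = 1\<close> there is nothing to test; since \<open>ln 0 = 0\<close>, the size is \<open>0\<close> in this case.\<close>

definition final_size :: "real \<Rightarrow> real \<Rightarrow> nat \<Rightarrow> nat" where
  "final_size \<epsilon> \<delta> c = nat \<lfloor>10 * ln (real (c choose 2) / \<delta>) / \<epsilon>\<^sup>2\<rfloor>"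

text \<open>
  The joint distribution of the surviving candidates, the collected candidates and the elapsed
  time after \<open>m\<close> rounds, for a fixed sample \<open>xs\<close>. Selecting from, and pairing up, a set \<open>V\<close> cost
  \<open>card V\<close> each, and adding \<open>A\<close> to the collection costs \<open>card A\<close>.
\<close>

primrec knockout ::
  "nat \<Rightarrow> (nat \<Rightarrow> nat pmf) \<Rightarrow> real \<Rightarrow> real \<Rightarrow> nat list \<Rightarrow> nat \<Rightarrow> (nat set \<times> nat set \<times> nat) pmf" where
  "knockout k v \<epsilon> \<delta> xs 0 = return_pmf ({1..k}, {}, k)"
| "knockout k v \<epsilon> \<delta> xs (Suc m) = do {
     (V, C, t) \<leftarrow> knockout k v \<epsilon> \<delta> xs m;
     A \<leftarrow> pmf_of_set {A. A \<subseteq> V \<and> card A = min (num_selected k) (card V)};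
     P \<leftarrow> pmf_of_set (pairings V);
     let ys = take (round_size \<epsilon> \<delta> (Suc m)) xs;
     return_pmf (pair_winner v ys ` P, C \<union> A,
                 t + 2 * card V + card A + (\<Sum>e\<in>P. scheffe_time ys))
   }"

definition all_pairs :: "nat set \<Rightarrow> nat set set" where
  "all_pairs C = {e. e \<subseteq> C \<and> card e = 2}"

definition wins :: "(nat \<Rightarrow> nat pmf) \<Rightarrow> nat list \<Rightarrow> nat set \<Rightarrow> nat \<Rightarrow> nat" where
  "wins v ys C j = card {e \<in> all_pairs C. pair_winner v ys e = j}"

definition most_wins :: "(nat \<Rightarrow> nat pmf) \<Rightarrow> nat list \<Rightarrow> nat set \<Rightarrow> nat set" where
  "most_wins v ys C = {j \<in> C. \<forall>i\<in>C. wins v ys C i \<le> wins v ys C j}"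

text \<open>
  Ties in the final step may be broken arbitrarily, so a run records the set of all admissible
  outputs, together with the number of points drawn from \<open>p\<close> and the elapsed time.
\<close>

record run =
  outputs :: "nat set"
  num_samples :: nat
  run_time :: nat

text \<open>
  The round sizes increase with the round, so the sample shared by all rounds needs the size of
  the last one. Drawing a point costs one time unit, and finding the most wins in \<open>C\<close> costs
  \<open>card C\<close>.
\<close>

definition select_hypothesis ::
  "nat \<Rightarrow> (nat \<Rightarrow> nat pmf) \<Rightarrow> nat pmf \<Rightarrow> real \<Rightarrow> real \<Rightarrow> run pmf" where
  "select_hypothesis k v p \<epsilon> \<delta> = do {
     xs \<leftarrow> replicate_pmf (round_size \<epsilon> \<delta> (num_rounds k)) p;
     (V, C, t) \<leftarrow> knockout k v \<epsilon> \<delta> xs (num_rounds k);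
     ys \<leftarrow> replicate_pmf (final_size \<epsilon> \<delta> (card C)) p;
     return_pmf \<lparr>
       outputs = most_wins v ys C,
       num_samples = length xs + length ys,
       run_time = length xs + t + length ys + (\<Sum>e\<in>all_pairs C. scheffe_time ys) + card C\<rparr>
   }"

end

theory Submission
  imports Defs
begin

text \<open>
  Let \<open>a\<close> be a best candidate and \<open>G\<close> the set of candidates whose distance to \<open>p\<close> is at most
  \<open>3 * l1_dist n p (v a) + 4 * \<epsilon>\<close>. An accurate Scheffe test never eliminates \<open>a\<close> against a
  candidate outside \<open>G\<close>. A round is therefore harmful only if its random subset misses \<open>G\<close> and \<open>a\<close>
  is paired within \<open>G\<close>, or if the test of \<open>a\<close> against its opponent is inaccurate. The first event
  has probability at most the inverse of the subset size, however large \<open>G\<close> is, because the subset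
  and the pairing are independent. For the second one, fix the sample: the opponent is uniform
  among the other survivors, so the conditional probability is proportional to the number of
  candidates whose test against \<open>a\<close> is inaccurate, and the expectation of that number over the
  sample is controlled by Hoeffding's inequality. Sharing one sample between the rounds is thus harmless.
  Hence some element of \<open>G\<close> is collected, and the final tournament multiplies the distance by at most 9.
\<close>

section \<open>Probability mass functions and concentration\<close>

lemma measure_bind_pmf_expectation:
  "measure_pmf.prob (bind_pmf M f) X = measure_pmf.expectation M (\<lambda>x. measure_pmf.prob (f x) X)"
proof -
  have "ennreal (measure_pmf.prob (bind_pmf M f) X) = (\<integral>\<^sup>+x. ennreal (measure_pmf.prob (f x) X) \<partial>M)"
    by (simp add: measure_pmf.emeasure_eq_measure [symmetric])
  also have "\<dots> = ennreal (measure_pmf.expectation M (\<lambda>x. measure_pmf.prob (f x) X))"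
    by (intro nn_integral_eq_integral measure_pmf.integrable_const_bound[where B=1]) auto
  finally show ?thesis
    by (simp add: integral_nonneg_AE)
qed

text \<open>On \<open>E\<close> the second-stage probability is bounded by 1, elsewhere by
  \<open>b\<close>. With \<open>E\<close> the failure of the preceding stage, failure probabilities
  add up stage by stage.\<close>

lemma measure_bind_pmf_le:
  assumes "\<And>x. x \<in> set_pmf M \<Longrightarrow> x \<notin> E \<Longrightarrow> measure_pmf.prob (f x) X \<le> b" "b \<ge> 0"
  shows "measure_pmf.prob (bind_pmf M f) X \<le> measure_pmf.prob M E + b"
proof -
  have int: "integrable (measure_pmf M) (\<lambda>x. measure_pmf.prob (f x) X)"
    by (intro measure_pmf.integrable_const_bound[where B=1]) auto
  have "measure_pmf.expectation M (\<lambda>x. measure_pmf.prob (f x) X) \<le>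
        measure_pmf.expectation M (\<lambda>x. indicator E x + b)"
  proof (rule integral_mono_AE[OF int])
    show "AE x in measure_pmf M. measure_pmf.prob (f x) X \<le> indicator E x + b"
      using assms by (auto simp: AE_measure_pmf_iff indicator_def intro: add_increasing2)
  qed (auto intro!: Bochner_Integration.integrable_add
         measure_pmf.integrable_const_bound[where B=1 and f="indicator E"])
  also have "\<dots> = measure_pmf.prob M E + b"
    by (subst Bochner_Integration.integral_add)
       (auto intro!: measure_pmf.integrable_const_bound[where B=1 and f="indicator E"])
  finally show ?thesis by (simp add: measure_bind_pmf_expectation)
qed

text \<open>Expresses the independence of the random subset and the random pairing of a
  round.\<close>

lemma prob_pair_pmf_Times:
  "measure_pmf.prob (pair_pmf M N) (A \<times> B) = measure_pmf.prob M A * measure_pmf.prob N B"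
proof -
  have "measure_pmf.prob (map_pmf (Pair x) N) (A \<times> B) = indicator A x * measure_pmf.prob N B" for x
    by (cases "x \<in> A") (simp_all add: vimage_def)
  moreover have "pair_pmf M N = M \<bind> (\<lambda>x. map_pmf (Pair x) N)"
    by (simp add: pair_pmf_def map_pmf_def)
  ultimately show ?thesis by (simp add: measure_bind_pmf_expectation)
qed

text \<open>Linearity of expectation: the counted events may depend on each other, as tests sharing
  one sample do.\<close>

lemma expectation_card_filter:
  assumes "finite J"
  shows "measure_pmf.expectation M (\<lambda>x. real (card {j \<in> J. R x j})) =
         (\<Sum>j\<in>J. measure_pmf.prob M {x. R x j})"
proof -
  have "real (card {j \<in> J. R x j}) = (\<Sum>j\<in>J. indicator {x. R x j} x)" for x
  proof -
    have "(\<Sum>j\<in>J. indicator {x. R x j} x) = (\<Sum>j\<in>J. if R x j then 1 else (0::real))"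
      by (intro sum.cong) auto
    thus ?thesis using assms by (simp add: sum.If_cases Int_def)
  qed
  moreover have "integrable (measure_pmf M) (indicator {x. R x j} :: _ \<Rightarrow> real)" for j
    by (intro measure_pmf.integrable_const_bound[where B=1]) (auto simp: indicator_def)
  ultimately show ?thesis by (simp add: Bochner_Integration.integral_sum)
qed

section \<open>Prefixes of samples and concentration of sample fractions\<close>

lemma replicate_pmf_map: "replicate_pmf n (map_pmf f p) = map_pmf (map f) (replicate_pmf n p)"
  by (induction n) (simp_all add: map_pmf_def bind_assoc_pmf bind_return_pmf)

text \<open>A bound for the tests of a single round may therefore ignore that all rounds read
  prefixes of the same sample.\<close>

lemma map_take_replicate_pmf:
  assumes "s \<le> n"
  shows "map_pmf (take s) (replicate_pmf n p) = replicate_pmf s p"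
proof -
  obtain d where n: "n = s + d" using assms le_Suc_ex by blast
  have "map_pmf (take s) (replicate_pmf n p) =
     do {xs \<leftarrow> replicate_pmf s p; ys \<leftarrow> replicate_pmf d p; return_pmf (take s (xs @ ys))}"
    by (simp add: n replicate_pmf_distrib map_pmf_def bind_assoc_pmf bind_return_pmf)
  also have "\<dots> = do {xs \<leftarrow> replicate_pmf s p; ys \<leftarrow> replicate_pmf d p; return_pmf xs}"
    by (intro bind_pmf_cong refl) (auto simp: set_replicate_pmf)
  finally show ?thesis by (simp add: bind_return_pmf')
qed

text \<open>Marking each draw by membership in \<open>S\<close> gives Bernoulli trials, which opens
  the way to Hoeffding's inequality for the binomial distribution.\<close>

lemma binomial_pmf_filter:
  "map_pmf (\<lambda>xs. length (filter (\<lambda>x. x \<in> S) xs)) (replicate_pmf n p) =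
   binomial_pmf n (measure_pmf.prob p S)"
proof -
  have b: "bernoulli_pmf (measure_pmf.prob p S) = map_pmf (\<lambda>x. x \<in> S) p"
  proof (rule pmf_eqI)
    fix b
    have "(\<lambda>x. x \<in> S) -` {b} = (if b then S else - S)" by auto
    moreover have "measure_pmf.prob p (- S) = 1 - measure_pmf.prob p S"
      using measure_pmf.prob_compl[of S p] by (simp add: Compl_eq_Diff_UNIV)
    ultimately show "pmf (bernoulli_pmf (measure_pmf.prob p S)) b = pmf (map_pmf (\<lambda>x. x \<in> S) p) b"
      by (cases b) (simp_all add: pmf_map)
  qed
  have "binomial_pmf n (measure_pmf.prob p S) =
     map_pmf (length \<circ> filter id) (map_pmf (map (\<lambda>x. x \<in> S)) (replicate_pmf n p))"
    by (subst Probability_Mass_Function.binomial_pmf_altdef) (simp_all add: b replicate_pmf_map)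
  also have "\<dots> = map_pmf (\<lambda>xs. length (filter (\<lambda>x. x \<in> S) xs)) (replicate_pmf n p)"
    by (simp add: map_pmf_comp filter_map o_def)
  finally show ?thesis by simp
qed

lemma sample_fraction_deviation:
  assumes "\<epsilon> \<ge> 0"
  shows "measure_pmf.prob (replicate_pmf n p)
           {xs. \<bar>sample_fraction xs S - measure_pmf.prob p S\<bar> > \<epsilon>} \<le> 2 * exp (- 2 * real n * \<epsilon>\<^sup>2)"
proof (cases "n = 0")
  \<comment> \<open>For an empty sample the bound is 2, hence trivial.\<close>
  case True
  have "measure_pmf.prob (replicate_pmf n p)
           {xs. \<bar>sample_fraction xs S - measure_pmf.prob p S\<bar> > \<epsilon>} \<le> 1"
    by (rule measure_pmf.prob_le_1)
  also have "\<dots> \<le> 2 * exp (- 2 * real n * \<epsilon>\<^sup>2)" using True by simp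
  finally show ?thesis .
next
  case False
  let ?q = "measure_pmf.prob p S"
  interpret binomial_distribution n ?q by unfold_locales simp
  have "measure_pmf.prob (replicate_pmf n p) {xs. \<bar>sample_fraction xs S - ?q\<bar> > \<epsilon>} \<le>
        measure_pmf.prob (replicate_pmf n p)
          ((\<lambda>xs. length (filter (\<lambda>x. x \<in> S) xs)) -` {x. \<bar>real x / n - ?q\<bar> \<ge> \<epsilon>})"
    by (rule measure_pmf.finite_measure_mono_AE)
       (auto simp: sample_fraction_def set_replicate_pmf AE_measure_pmf_iff)
  also have "\<dots> = measure_pmf.prob (binomial_pmf n ?q) {x. \<bar>real x / n - ?q\<bar> \<ge> \<epsilon>}"
    by (simp add: binomial_pmf_filter[symmetric])
  also have "\<dots> \<le> 2 * exp (- 2 * real n * \<epsilon>\<^sup>2)"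
    using False assms prob_abs_ge'[of \<epsilon>] by simp
  finally show ?thesis .
qed

text \<open>Rounding the size down costs at most \<open>\<epsilon>\<^sup>2 \<le> 1\<close> in
  \<open>real s * \<epsilon>\<^sup>2\<close>; doubled in the exponent, this is the factor
  \<open>exp 2\<close>. The remaining decay, \<open>y\<close> to the power -20, is weakened to
  \<open>1 / y\<close>.\<close>

lemma sample_fraction_deviation_log_size:
  assumes "0 < \<epsilon>" "\<epsilon> \<le> 1" "y \<ge> 1" "s = nat \<lfloor>10 * ln y / \<epsilon>\<^sup>2\<rfloor>"
  shows "measure_pmf.prob (replicate_pmf s p)
           {xs. \<bar>sample_fraction xs S - measure_pmf.prob p S\<bar> > \<epsilon>} \<le> 2 * exp 2 / y"
proof -
  have s: "real s \<ge> 10 * ln y / \<epsilon>\<^sup>2 - 1"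
    using assms by linarith
  have "real s * \<epsilon>\<^sup>2 \<ge> (10 * ln y / \<epsilon>\<^sup>2 - 1) * \<epsilon>\<^sup>2"
    by (intro mult_right_mono s) auto
  moreover have "(10 * ln y / \<epsilon>\<^sup>2 - 1) * \<epsilon>\<^sup>2 = 10 * ln y - \<epsilon>\<^sup>2"
    using assms by (simp add: field_simps)
  moreover have "\<epsilon>\<^sup>2 \<le> 1" using assms by (simp add: power_le_one)
  moreover have "ln y \<ge> 0" using assms by simp
  ultimately have "- 2 * real s * \<epsilon>\<^sup>2 \<le> 2 - ln y" by linarith
  hence "exp (- 2 * real s * \<epsilon>\<^sup>2) \<le> exp (2 - ln y)" by simp
  also have "\<dots> = exp 2 / y" using assms by (simp add: exp_diff)
  finally show ?thesis
    using sample_fraction_deviation[of \<epsilon> s p S] assms by simp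
qed

section \<open>The Scheffe test\<close>

lemma prob_eq_sum_support:
  assumes "set_pmf q \<subseteq> A" "finite A"
  shows "measure_pmf.prob q T = (\<Sum>x\<in>A. if x \<in> T then pmf q x else 0)"
proof -
  have "measure_pmf.prob q T = measure_pmf.prob q (A \<inter> T)"
    using assms by (metis (no_types, lifting) Int_absorb1 Int_assoc Int_commute measure_Int_set_pmf)
  also have "\<dots> = sum (pmf q) (A \<inter> T)" using assms by (simp add: measure_measure_pmf_finite)
  also have "\<dots> = (\<Sum>x\<in>A. if x \<in> T then pmf q x else 0)"
    using assms by (simp add: sum.inter_restrict)
  finally show ?thesis .
qed

text \<open>With d the pointwise difference of the masses, |d| = 2 max(d, 0) - d, and d sums to 0
  because both distributions have total mass 1.\<close>

lemma l1_dist_scheffe_set: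
  assumes "set_pmf q \<subseteq> {1..n}" "set_pmf r \<subseteq> {1..n}"
  shows "l1_dist n q r =
    2 * (measure_pmf.prob q (scheffe_set q r) - measure_pmf.prob r (scheffe_set q r))"
proof -
  let ?S = "scheffe_set q r"
  have "l1_dist n q r = (\<Sum>x=1..n. 2 * ((if x \<in> ?S then pmf q x else 0) -
          (if x \<in> ?S then pmf r x else 0)) - (pmf q x - pmf r x))"
    unfolding l1_dist_def by (intro sum.cong) (auto simp: scheffe_set_def)
  also have "\<dots> = 2 * (measure_pmf.prob q ?S - measure_pmf.prob r ?S)
      - ((\<Sum>x=1..n. pmf q x) - (\<Sum>x=1..n. pmf r x))"
    using assms by (simp add: prob_eq_sum_support[of _ "{1..n}"] sum_subtractf sum_distrib_left)
  finally show ?thesis using assms by (simp add: sum_pmf_eq_1)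
qed

text \<open>Subtracting the vanishing sum of all differences gives each summand the sign + on
  \<open>T\<close> and - off \<open>T\<close>, so its absolute value is that of the pointwise
  difference. This yields the factor 2.\<close>

lemma prob_diff_le_l1_dist:
  assumes "set_pmf q \<subseteq> {1..n}" "set_pmf r \<subseteq> {1..n}"
  shows "2 * \<bar>measure_pmf.prob q T - measure_pmf.prob r T\<bar> \<le> l1_dist n q r"
proof -
  have "2 * (measure_pmf.prob q T - measure_pmf.prob r T) =
    (\<Sum>x=1..n. 2 * ((if x \<in> T then pmf q x else 0) - (if x \<in> T then pmf r x else 0))
       - (pmf q x - pmf r x))"
    using assms
    by (simp add: prob_eq_sum_support[of _ "{1..n}"] sum_subtractf sum_distrib_left sum_pmf_eq_1)
  also have "\<bar>\<dots>\<bar> \<le> l1_dist n q r"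
    unfolding l1_dist_def by (rule order.trans[OF sum_abs]) (auto intro!: sum_mono)
  finally show ?thesis by linarith
qed

lemma l1_dist_triangle: "l1_dist n p r \<le> l1_dist n p q + l1_dist n q r"
  unfolding l1_dist_def sum.distrib[symmetric] by (intro sum_mono) linarith

lemma l1_dist_commute: "l1_dist n p q = l1_dist n q p"
  unfolding l1_dist_def by (simp add: abs_minus_commute)

lemma l1_dist_nonneg: "l1_dist n p q \<ge> 0"
  unfolding l1_dist_def by (simp add: sum_nonneg)

text \<open>Settles the case \<epsilon> > 1, which the concentration bound for rounded sample sizes
  does not cover.\<close>

lemma l1_dist_le_2:
  assumes "set_pmf q \<subseteq> {1..n}" "set_pmf r \<subseteq> {1..n}"
  shows "l1_dist n q r \<le> 2"
proof -
  have "l1_dist n q r \<le> (\<Sum>x=1..n. pmf q x + pmf r x)"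
    unfolding l1_dist_def
    by (intro sum_mono) (smt (verit) pmf_nonneg)
  thus ?thesis using assms by (simp add: sum.distrib sum_pmf_eq_1)
qed

definition pair_set :: "(nat \<Rightarrow> nat pmf) \<Rightarrow> nat set \<Rightarrow> nat set" where
  "pair_set v e = scheffe_set (v (Min e)) (v (Max e))"

text \<open>The randomness of a test is reduced to this event; given it, the outcome is analysed
  deterministically.\<close>

definition accurate :: "(nat \<Rightarrow> nat pmf) \<Rightarrow> nat pmf \<Rightarrow> real \<Rightarrow> nat list \<Rightarrow> nat set \<Rightarrow> bool" where
  "accurate v p \<epsilon> xs e \<longleftrightarrow>
     \<bar>sample_fraction xs (pair_set v e) - measure_pmf.prob p (pair_set v e)\<bar> \<le> \<epsilon>"

lemma pair_winner_in:
  assumes "card e = 2"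
  shows "pair_winner v xs e \<in> e"
proof -
  have "finite e" "e \<noteq> {}" using assms card.infinite by force+
  thus ?thesis by (auto simp: pair_winner_def scheffe_test_def Let_def)
qed

text \<open>On \<open>S\<close>, \<open>v b\<close> is at least as close to the sample fraction as
  \<open>v a\<close>, so their masses differ by at most twice the deviation of \<open>v a\<close>,
  which is at most half its distance to \<open>p\<close> plus \<epsilon>. The distance of the two
  candidates is twice the difference of these masses; the triangle inequality then adds one more
  \<open>l1_dist n p (v a)\<close>.\<close>

lemma pair_winner_l1_dist:
  assumes supp: "set_pmf (v a) \<subseteq> {1..n}" "set_pmf (v b) \<subseteq> {1..n}" "set_pmf p \<subseteq> {1..n}"
    and "a \<noteq> b" and acc: "accurate v p \<epsilon> xs {a, b}" and win: "pair_winner v xs {a, b} = b"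
  shows "l1_dist n p (v b) \<le> 3 * l1_dist n p (v a) + 4 * \<epsilon>"
proof -
  define S where "S = pair_set v {a, b}"
  define \<mu> where "\<mu> = sample_fraction xs S"
  let ?P = "\<lambda>q. measure_pmf.prob q S"
  \<comment> \<open>Ties go to the smaller index, so a win of \<open>b\<close> is a strict
    inequality for \<open>a < b\<close> and a weak one otherwise; the weak form covers both. In
    either order the gap on \<open>S\<close> is half the distance.\<close>
  have *: "\<bar>?P (v b) - \<mu>\<bar> \<le> \<bar>?P (v a) - \<mu>\<bar> \<and> l1_dist n (v a) (v b) = 2 * \<bar>?P (v a) - ?P (v b)\<bar>"
  proof (cases "a < b")
    case True
    hence m: "Min {a, b} = a" "Max {a, b} = b" by auto
    have "S = scheffe_set (v a) (v b)" by (simp add: S_def pair_set_def m)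
    moreover have "\<bar>?P (v b) - \<mu>\<bar> \<le> \<bar>?P (v a) - \<mu>\<bar>"
      using win \<open>a \<noteq> b\<close>
      by (auto simp: pair_winner_def scheffe_test_def m Let_def \<mu>_def S_def pair_set_def
          split: if_splits)
    ultimately show ?thesis
      using l1_dist_scheffe_set[OF supp(1,2)] l1_dist_nonneg[of n "v a" "v b"] by simp
  next
    case False
    with \<open>a \<noteq> b\<close> have m: "Min {a, b} = b" "Max {a, b} = a" by auto
    have "S = scheffe_set (v b) (v a)" by (simp add: S_def pair_set_def m)
    moreover have "\<bar>?P (v b) - \<mu>\<bar> \<le> \<bar>?P (v a) - \<mu>\<bar>"
      using win \<open>a \<noteq> b\<close>
      by (auto simp: pair_winner_def scheffe_test_def m Let_def \<mu>_def S_def pair_set_def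
          split: if_splits)
    ultimately show ?thesis
      using l1_dist_scheffe_set[OF supp(2,1)] l1_dist_nonneg[of n "v b" "v a"]
        l1_dist_commute[of n "v a" "v b"] by simp
  qed
  have "\<bar>\<mu> - ?P p\<bar> \<le> \<epsilon>" using acc by (simp add: accurate_def S_def \<mu>_def)
  moreover have "2 * \<bar>?P p - ?P (v a)\<bar> \<le> l1_dist n p (v a)"
    by (rule prob_diff_le_l1_dist) (use supp in auto)
  moreover have "l1_dist n p (v b) \<le> l1_dist n p (v a) + l1_dist n (v a) (v b)"
    by (rule l1_dist_triangle)
  moreover have "l1_dist n (v a) (v b) \<le> 4 * \<bar>?P (v a) - \<mu>\<bar>"
    using *[THEN conjunct1] *[THEN conjunct2]
      abs_triangle_ineq4[of "?P (v a) - \<mu>" "?P (v b) - \<mu>"] by simp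
  moreover have "\<bar>?P (v a) - \<mu>\<bar> \<le> \<bar>?P p - ?P (v a)\<bar> + \<bar>\<mu> - ?P p\<bar>" by linarith
  ultimately show ?thesis by (smt (verit))
qed

section \<open>The final tournament\<close>

lemma finite_all_pairs: "finite C \<Longrightarrow> finite (all_pairs C)"
  unfolding all_pairs_def by (rule finite_subset[of _ "Pow C"]) auto

lemma most_wins_nonempty:
  assumes "finite C" "C \<noteq> {}"
  shows "most_wins v ys C \<noteq> {}"
proof -
  have "Max (wins v ys C ` C) \<in> wins v ys C ` C" using assms by simp
  then obtain j where "j \<in> C" "wins v ys C j = Max (wins v ys C ` C)" by auto
  hence "j \<in> C \<and> (\<forall>i\<in>C. wins v ys C i \<le> wins v ys C j)" using assms by simp
  thus ?thesis by (auto simp: most_wins_def)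
qed

text \<open>A pair won by \<open>j\<close> contains \<open>j\<close>, so the opponent determines
  it.\<close>

lemma wins_eq_card_beaten:
  assumes "finite C" "j \<in> C"
  shows "wins v ys C j = card {i \<in> C - {j}. pair_winner v ys {i, j} = j}"
proof -
  have "{e \<in> all_pairs C. pair_winner v ys e = j} =
        (\<lambda>i. {i, j}) ` {i \<in> C - {j}. pair_winner v ys {i, j} = j}" (is "?L = ?R")
  proof (intro equalityI subsetI)
    fix e assume e: "e \<in> ?L"
    hence "e \<subseteq> C" "card e = 2" by (auto simp: all_pairs_def)
    moreover have "j \<in> e" using e pair_winner_in[of e v ys] by (auto simp: all_pairs_def)
    ultimately obtain i where "e = {i, j}" "i \<noteq> j" "i \<in> C"
      by (auto simp: card_2_iff doubleton_eq_iff)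
    with e show "e \<in> ?R" by auto
  next
    fix e assume "e \<in> ?R"
    thus "e \<in> ?L" using assms by (auto simp: all_pairs_def)
  qed
  moreover have "inj_on (\<lambda>i. {i, j}) {i \<in> C - {j}. pair_winner v ys {i, j} = j}"
    by (auto simp: inj_on_def doubleton_eq_iff)
  ultimately show ?thesis by (simp add: wins_def card_image)
qed

text \<open>
  With \<open>H\<close> the candidates within distance \<open>3 * l1_dist n p (v c) + 4 * \<epsilon>\<close>, candidate \<open>c\<close> loses
  at most against \<open>H - {c}\<close>, while a candidate violating the bound loses against all of \<open>H\<close>.
\<close>

lemma most_wins_l1_dist:
  assumes supp: "\<And>j. j \<in> C \<Longrightarrow> set_pmf (v j) \<subseteq> {1..n}" "set_pmf p \<subseteq> {1..n}"
    and C: "finite C" "c \<in> C" and acc: "\<And>e. e \<in> all_pairs C \<Longrightarrow> accurate v p \<epsilon> ys e"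
    and j: "j \<in> most_wins v ys C" and "\<epsilon> \<ge> 0"
  shows "l1_dist n p (v j) \<le> 9 * l1_dist n p (v c) + 16 * \<epsilon>"
proof (rule ccontr)
  let ?d = "\<lambda>i. l1_dist n p (v i)"
  assume far: "\<not> ?d j \<le> 9 * ?d c + 16 * \<epsilon>"
  have jC: "j \<in> C" and best: "wins v ys C c \<le> wins v ys C j"
    using j C by (auto simp: most_wins_def)
  have acc': "accurate v p \<epsilon> ys {a, b}" if "a \<in> C" "b \<in> C" "a \<noteq> b" for a b
    using that by (intro acc) (auto simp: all_pairs_def)
  define H where "H = {i \<in> C. ?d i \<le> 3 * ?d c + 4 * \<epsilon>}"
  have H: "H \<subseteq> C" "c \<in> H" using C \<open>\<epsilon> \<ge> 0\<close> l1_dist_nonneg[of n p "v c"] by (auto simp: H_def)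
  have jH: "j \<notin> H" using far \<open>\<epsilon> \<ge> 0\<close> l1_dist_nonneg[of n p "v c"] by (auto simp: H_def)
  have "C - H \<subseteq> {i \<in> C - {c}. pair_winner v ys {i, c} = c}"
  proof
    fix i assume i: "i \<in> C - H"
    hence "i \<noteq> c" using H by auto
    moreover have "pair_winner v ys {i, c} \<noteq> i"
    proof
      assume "pair_winner v ys {i, c} = i"
      with pair_winner_l1_dist[of v c n i p \<epsilon> ys] supp acc'[of c i] C i \<open>i \<noteq> c\<close>
      show False by (auto simp: insert_commute H_def)
    qed
    ultimately show "i \<in> {i \<in> C - {c}. pair_winner v ys {i, c} = c}"
      using i pair_winner_in[of "{i, c}" v ys] by auto
  qed
  hence 1: "card (C - H) \<le> wins v ys C c"
    using C by (simp add: wins_eq_card_beaten card_mono)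
  have "{i \<in> C - {j}. pair_winner v ys {i, j} = j} \<subseteq> C - H - {j}"
  proof
    fix i assume i: "i \<in> {i \<in> C - {j}. pair_winner v ys {i, j} = j}"
    have "i \<notin> H"
    proof
      assume "i \<in> H"
      with pair_winner_l1_dist[of v i n j p \<epsilon> ys] supp acc'[of i j] jC i far \<open>\<epsilon> \<ge> 0\<close>
      show False by (auto simp: H_def)
    qed
    with i show "i \<in> C - H - {j}" by auto
  qed
  hence "wins v ys C j \<le> card (C - H - {j})"
    using C jC by (simp add: wins_eq_card_beaten card_mono)
  also have "\<dots> < card (C - H)" using C jC jH by (intro psubset_card_mono) auto
  finally show False using 1 best by simp
qed

section \<open>Random pairings and random subsets\<close>

text \<open>The uniform distribution on \<open>pairings V\<close> is meaningful only if a pairing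
  exists; one is built by removing two elements at a time.\<close>

lemma pairings_nonempty:
  assumes "finite V" "even (card V)"
  shows "pairings V \<noteq> {}"
  using assms
proof (induction "card V" arbitrary: V rule: less_induct)
  case less
  show ?case
  proof (cases "V = {}")
    case True
    thus ?thesis by (auto simp: pairings_def partition_on_empty)
  next
    case False
    then obtain a where a: "a \<in> V" by blast
    have "V \<noteq> {a}" using less.prems by auto
    hence "\<exists>b. b \<in> V \<and> b \<noteq> a" using a by blast
    then obtain b where b: "b \<in> V" "b \<noteq> a" by blast
    define W where "W = V - {a, b}"
    have card: "card W + 2 = card V"
      using a b less.prems card_mono[of V "{a, b}"] by (simp add: W_def card_Diff_subset)
    have "pairings W \<noteq> {}"
    proof (rule less.hyps)
      show "card W < card V" using card by simp
      show "even (card W)" using card less.prems even_add[of "card W" 2] by simp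
    qed (use less.prems in \<open>auto simp: W_def\<close>)
    then obtain P where P: "P \<in> pairings W" by blast
    have "insert {a, b} P \<in> pairings V"
      using P a b by (auto simp: pairings_def partition_on_def W_def pairwise_insert disjnt_def)
    thus ?thesis by blast
  qed
qed

lemma finite_pairings: "finite V \<Longrightarrow> finite (pairings V)"
  unfolding pairings_def by (rule finite_subset[OF _ finitely_many_partition_on]) auto

lemma card_pairing:
  assumes "finite V" "P \<in> pairings V"
  shows "card V = 2 * card P" "finite P"
proof -
  have P: "partition_on V P" "\<And>e. e \<in> P \<Longrightarrow> card e = 2" using assms by (auto simp: pairings_def)
  show "finite P" using finite_elements[OF assms(1) P(1)] .
  have "card V = (\<Sum>e\<in>P. card e)"
    using P by (intro product_partition) (auto intro: card_ge_0_finite)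
  thus "card V = 2 * card P" using P by simp
qed

lemma pairing_subset: "P \<in> pairings V \<Longrightarrow> e \<in> P \<Longrightarrow> e \<subseteq> V \<and> card e = 2"
  by (auto simp: pairings_def partition_on_def)

lemma pairing_disjoint: "P \<in> pairings V \<Longrightarrow> e \<in> P \<Longrightarrow> e' \<in> P \<Longrightarrow> x \<in> e \<Longrightarrow> x \<in> e' \<Longrightarrow> e = e'"
  unfolding pairings_def partition_on_def pairwise_def disjnt_def by blast

lemma pairing_has_partner:
  assumes "P \<in> pairings V" "a \<in> V"
  obtains b where "b \<in> V - {a}" "{a, b} \<in> P"
proof -
  obtain e where e: "e \<in> P" "a \<in> e" using assms by (auto simp: pairings_def partition_on_def)
  moreover have "e \<subseteq> V" "card e = 2" using pairing_subset[OF assms(1) e(1)] by auto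
  ultimately obtain b where "e = {a, b}" "b \<noteq> a" by (auto simp: card_2_iff doubleton_eq_iff)
  thus ?thesis using e \<open>e \<subseteq> V\<close> by (intro that[of b]) auto
qed

text \<open>Swapping \<open>b\<close> and \<open>b'\<close> fixes \<open>a\<close> and
  \<open>V\<close> and acts injectively on pairings. Used in both directions, it makes all partners
  of \<open>a\<close> equally likely.\<close>

lemma card_pairings_containing_le:
  assumes "finite V" "b \<in> V - {a}" "b' \<in> V - {a}"
  shows "card {P \<in> pairings V. {a, b} \<in> P} \<le> card {P \<in> pairings V. {a, b'} \<in> P}"
proof (rule card_inj_on_le)
  let ?\<pi> = "Transposition.transpose b b'"
  have bij: "bij ?\<pi>" by simp
  hence inj: "inj ((`) ?\<pi>)" by (intro inj_on_image) (simp add: bij_is_inj)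
  show "inj_on ((`) ((`) ?\<pi>)) {P \<in> pairings V. {a, b} \<in> P}"
    using inj by (intro inj_on_image) (auto intro: inj_on_subset)
  have V: "?\<pi> ` V = V"
    using assms by (auto simp: transpose_image_eq)
  show "(`) ((`) ?\<pi>) ` {P \<in> pairings V. {a, b} \<in> P} \<subseteq> {P \<in> pairings V. {a, b'} \<in> P}"
  proof (intro image_subsetI CollectI conjI)
    fix P assume P: "P \<in> {P \<in> pairings V. {a, b} \<in> P}"
    hence part: "partition_on V P" and card: "\<And>e. e \<in> P \<Longrightarrow> card e = 2"
      by (auto simp: pairings_def)
    have "partition_on V ((`) ?\<pi> ` P - {{}})"
      using partition_on_inj_image[OF part, of ?\<pi>] bij_is_inj[OF bij]
      by (auto simp: V intro: inj_on_subset)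
    moreover have "(`) ?\<pi> ` P - {{}} = (`) ?\<pi> ` P" using partition_onD3[OF part] by auto
    moreover have "card (?\<pi> ` e) = card e" for e
      by (rule card_image) (rule inj_on_subset[OF bij_is_inj[OF bij]], simp)
    ultimately show "(`) ?\<pi> ` P \<in> pairings V" using card by (auto simp: pairings_def)
    have "?\<pi> ` {a, b} = {a, b'}" using assms by (simp add: transpose_def)
    thus "{a, b'} \<in> (`) ?\<pi> ` P" using P by (metis (no_types, lifting) image_eqI mem_Collect_eq)
  qed
  show "finite {P \<in> pairings V. {a, b'} \<in> P}" using finite_pairings[OF assms(1)] by simp
qed

text \<open>The partner of \<open>a\<close> splits the pairings into classes of equal size. This
  size cancels, so the number of pairings is never computed.\<close>

lemma pairing_partner_prob:
  assumes V: "finite V" "even (card V)" "a \<in> V" and B: "B \<subseteq> V - {a}"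
  shows "measure_pmf.prob (pmf_of_set (pairings V)) {P. \<exists>b\<in>B. {a, b} \<in> P} =
         real (card B) / real (card V - 1)"
proof -
  let ?F = "\<lambda>b. {P \<in> pairings V. {a, b} \<in> P}"
  note fin = finite_pairings[OF V(1)]
  have ne: "pairings V \<noteq> {}" by (rule pairings_nonempty[OF V(1,2)])
  have "card V \<noteq> 0" "card V \<noteq> 1" using V by auto
  hence "card V - 1 > 0" by linarith
  hence "card (V - {a}) > 0" using V by simp
  then obtain b\<^sub>0 where b0: "b\<^sub>0 \<in> V - {a}" by (metis card_gt_0_iff ex_in_conv)
  have const: "card (?F b) = card (?F b\<^sub>0)" if "b \<in> V - {a}" for b
    using card_pairings_containing_le[OF V(1)] that b0 by (meson le_antisym)
  have count: "card {P \<in> pairings V. \<exists>b\<in>D. {a, b} \<in> P} = card D * card (?F b\<^sub>0)"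
    if D: "D \<subseteq> V - {a}" for D
  proof -
    have disj: "?F b \<inter> ?F b' = {}" if "b \<noteq> b'" for b b'
      using that pairing_disjoint[of _ V "{a, b}" "{a, b'}" a] by (auto simp: doubleton_eq_iff)
    have "{P \<in> pairings V. \<exists>b\<in>D. {a, b} \<in> P} = (\<Union>b\<in>D. ?F b)" by auto
    also have "card \<dots> = (\<Sum>b\<in>D. card (?F b))"
      using D V fin disj by (intro card_UN_disjoint) (auto intro: finite_subset)
    also have "\<dots> = (\<Sum>b\<in>D. card (?F b\<^sub>0))" using D const by (intro sum.cong refl) auto
    finally show ?thesis by simp
  qed
  have "pairings V = {P \<in> pairings V. \<exists>b\<in>V - {a}. {a, b} \<in> P}"
    using V by (auto elim: pairing_has_partner)
  hence all: "card (pairings V) = (card V - 1) * card (?F b\<^sub>0)"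
    using count[of "V - {a}"] V by simp
  have "card (pairings V) > 0" using ne fin by (simp add: card_gt_0_iff)
  hence pos: "card (?F b\<^sub>0) > 0" unfolding all by simp
  have "pairings V \<inter> {P. \<exists>b\<in>B. {a, b} \<in> P} = {P \<in> pairings V. \<exists>b\<in>B. {a, b} \<in> P}" by auto
  thus ?thesis using pos by (simp add: measure_pmf_of_set[OF ne fin] count[OF B] all)
qed

section \<open>Random subsets and the loss in one round\<close>

lemma prob_random_subset_misses:
  assumes "finite V" "t \<le> card V"
  shows "measure_pmf.prob (pmf_of_set {A. A \<subseteq> V \<and> card A = t}) {A. A \<inter> G = {}} =
         real (card V - card (V \<inter> G) choose t) / real (card V choose t)"
proof -
  let ?S = "{A. A \<subseteq> V \<and> card A = t}"
  have fin: "finite ?S" by (rule finite_subset[of _ "Pow V"]) (use assms in auto)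
  have "?S \<noteq> {}" using obtain_subset_with_card_n[OF assms(2)] by blast
  moreover have "?S \<inter> {A. A \<inter> G = {}} = {A. A \<subseteq> V - G \<and> card A = t}" by auto
  moreover have "card (V - G) = card V - card (V \<inter> G)"
    using assms by (metis card_Diff_subset_Int finite_Int)
  ultimately show ?thesis using assms fin
    by (simp add: measure_pmf_of_set n_subsets)
qed

text \<open>
  By Vandermonde's identity there are at least \<open>g * (N - g choose t)\<close> subsets of size \<open>t + 1\<close>
  with exactly one element among \<open>g\<close> given ones.
\<close>

lemma binomial_miss_bound:
  fixes g N t :: nat
  assumes "1 \<le> g" "g \<le> N" "t \<le> N"
  shows "real (N - g choose t) / real (N choose t) * (real g / real N) \<le> 1 / (real t + 1)"
proof -
  have "(g choose 1) * ((N - g) choose (Suc t - 1)) \<le>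
        (\<Sum>i\<le>Suc t. (g choose i) * ((N - g) choose (Suc t - i)))"
    by (rule member_le_sum) auto
  also have "\<dots> = N choose Suc t" using assms by (simp add: vandermonde)
  finally have "g * (N - g choose t) \<le> N choose Suc t" by simp
  hence "Suc t * (g * (N - g choose t)) \<le> Suc t * (N choose Suc t)" by (rule mult_le_mono2)
  also have "\<dots> = (N - t) * (N choose t)"
    by (simp only: binomial_absorption binomial_absorb_comp)
  also have "\<dots> \<le> N * (N choose t)" by simp
  finally have "real (Suc t * (g * (N - g choose t))) \<le> real (N * (N choose t))"
    by (simp only: of_nat_le_iff)
  moreover have "real (N choose t) > 0" using assms by simp
  ultimately show ?thesis using assms by (simp add: field_simps)
qed

text \<open>
  If no element of \<open>G\<close> is selected, then \<open>a\<close> can only be eliminated when paired with another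
  element of \<open>G\<close> or with an element of \<open>B\<close>. Writing \<open>x\<close> for the proportion of \<open>G\<close>, the product of
  the probabilities of missing \<open>G\<close> and of being paired with it is about \<open>(1 - x) ^ t * x\<close>,
  which is small for every \<open>x\<close>.
\<close>

lemma round_loss_prob:
  assumes V: "finite V" "even (card V)" "a \<in> V" "a \<in> G" "t \<le> card V"
    and B: "finite B" and win: "\<And>b. b \<in> V - {a} \<Longrightarrow> b \<notin> G \<Longrightarrow> b \<notin> B \<Longrightarrow> w {a, b} = a"
  shows "measure_pmf.prob (pmf_of_set {A. A \<subseteq> V \<and> card A = t}) {A. A \<inter> G = {}} *
         measure_pmf.prob (pmf_of_set (pairings V)) {P. a \<notin> w ` P}
         \<le> 1 / (real t + 1) + 2 * real (card B) / real (card V)"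
proof -
  let ?x = "measure_pmf.prob (pmf_of_set {A. A \<subseteq> V \<and> card A = t}) {A. A \<inter> G = {}}"
  let ?L = "(V \<inter> G - {a}) \<union> (B \<inter> V - {a})"
  define N where "N = card V"
  define g where "g = card (V \<inter> G)"
  have "N \<noteq> 0" "N \<noteq> 1" using V by (auto simp: N_def)
  hence N: "N \<ge> 2" by simp
  have g: "1 \<le> g" "g \<le> N" using V by (auto simp: g_def N_def Suc_le_eq card_gt_0_iff intro: card_mono)
  have ne: "pairings V \<noteq> {}" by (rule pairings_nonempty[OF V(1,2)])
  have "measure_pmf.prob (pmf_of_set (pairings V)) {P. a \<notin> w ` P} \<le>
        measure_pmf.prob (pmf_of_set (pairings V)) {P. \<exists>b\<in>?L. {a, b} \<in> P}"
  proof (rule measure_pmf.finite_measure_mono_AE)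
    show "AE P in pmf_of_set (pairings V). P \<in> {P. a \<notin> w ` P} \<longrightarrow> P \<in> {P. \<exists>b\<in>?L. {a, b} \<in> P}"
    proof (clarsimp simp: AE_measure_pmf_iff set_pmf_of_set[OF ne finite_pairings[OF V(1)]])
      fix P assume P: "P \<in> pairings V" "a \<notin> w ` P"
      obtain b where b: "b \<in> V - {a}" "{a, b} \<in> P" using pairing_has_partner[OF P(1) V(3)] .
      hence "w {a, b} \<noteq> a" using P by force
      hence "b \<in> G \<or> b \<in> B" using win b by blast
      thus "\<exists>b\<in>?L. {a, b} \<in> P" using b by blast
    qed
  qed simp
  also have "\<dots> = real (card ?L) / real (N - 1)"
    unfolding N_def by (rule pairing_partner_prob) (use V in auto)
  also have "\<dots> \<le> (real (g - 1) + real (card B)) / real (N - 1)"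
  proof (intro divide_right_mono)
    have "card ?L \<le> card (V \<inter> G - {a}) + card (B \<inter> V - {a})" by (rule card_Un_le)
    also have "card (V \<inter> G - {a}) = g - 1" using V by (simp add: g_def)
    also have "card (B \<inter> V - {a}) \<le> card B" using B by (intro card_mono) auto
    finally show "real (card ?L) \<le> real (g - 1) + real (card B)" by linarith
  qed simp
  also have "\<dots> = real (g - 1) / real (N - 1) + real (card B) / real (N - 1)"
    by (rule add_divide_distrib)
  \<comment> \<open>Removing \<open>a\<close> from both counts does not increase a ratio that is at
    most 1; this reaches the form of \<open>binomial_miss_bound\<close>.\<close>
  also have "real (g - 1) / real (N - 1) \<le> real g / real N"
    using g N by (simp add: of_nat_diff field_simps)
  also have "real (card B) / real (N - 1) \<le> 2 * real (card B) / real N"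
  proof -
    have "real (card B) * real N \<le> real (card B) * (2 * real (N - 1))"
      using N by (intro mult_left_mono) (auto simp: of_nat_diff)
    thus ?thesis using N by (simp add: field_simps)
  qed
  finally have "measure_pmf.prob (pmf_of_set (pairings V)) {P. a \<notin> w ` P} \<le>
      real g / real N + 2 * real (card B) / real N" by simp
  hence "?x * measure_pmf.prob (pmf_of_set (pairings V)) {P. a \<notin> w ` P} \<le>
      ?x * (real g / real N + 2 * real (card B) / real N)" by (intro mult_left_mono) auto
  also have "\<dots> = ?x * (real g / real N) + ?x * (2 * real (card B) / real N)"
    by (rule distrib_left)
  also have "?x * (real g / real N) \<le> 1 / (real t + 1)"
    using binomial_miss_bound[OF g, of t] V(5)
    by (simp add: prob_random_subset_misses[OF V(1,5)] g_def N_def)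
  also have "?x * (2 * real (card B) / real N) \<le> 1 * (2 * real (card B) / real N)"
    by (intro mult_right_mono) auto
  finally show ?thesis by (simp add: N_def)
qed

section \<open>The knockout rounds\<close>

lemma num_selected_ge_1: "k \<ge> 1 \<Longrightarrow> num_selected k \<ge> 1"
  unfolding num_selected_def using ge_one_powr_ge_zero[of "real k" "1/3"]
  by (simp add: le_nat_iff le_floor_iff)

lemma set_pmf_random_subset:
  assumes "finite V"
  shows "set_pmf (pmf_of_set {A. A \<subseteq> V \<and> card A = min t (card V)}) =
         {A. A \<subseteq> V \<and> card A = min t (card V)}"
proof (rule set_pmf_of_set)
  show "{A. A \<subseteq> V \<and> card A = min t (card V)} \<noteq> {}"
    using obtain_subset_with_card_n[of "min t (card V)" V] by auto
  show "finite {A. A \<subseteq> V \<and> card A = min t (card V)}"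
    by (rule finite_subset[of _ "Pow V"]) (use assms in auto)
qed

lemma set_pmf_random_pairing:
  assumes "finite V" "even (card V)"
  shows "set_pmf (pmf_of_set (pairings V)) = pairings V"
  using assms by (intro set_pmf_of_set pairings_nonempty finite_pairings)

lemma winners_of_pairing:
  assumes "finite V" "P \<in> pairings V"
  shows "pair_winner v ys ` P \<subseteq> V" "2 * card (pair_winner v ys ` P) = card V"
proof -
  have in_e: "pair_winner v ys e \<in> e" if "e \<in> P" for e
    using pair_winner_in pairing_subset[OF assms(2) that] by blast
  show "pair_winner v ys ` P \<subseteq> V"
    using in_e pairing_subset[OF assms(2)] by blast
  have "inj_on (pair_winner v ys) P"
    by (rule inj_onI) (metis in_e pairing_disjoint[OF assms(2)])
  thus "2 * card (pair_winner v ys ` P) = card V"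
    using card_pairing[OF assms] by (simp add: card_image)
qed

text \<open>An invariant of all reachable states, for every sample. Its part on
  \<open>V \<subseteq> C\<close> will ensure that the last survivor is collected. In the time bound,
  \<open>card A\<close> is absorbed into the factor 3.\<close>

lemma knockout_support:
  assumes k: "k = 2 ^ m" and "i \<le> m" "(V, C, t) \<in> set_pmf (knockout k v \<epsilon> \<delta> xs i)"
  shows "V \<subseteq> {1..k} \<and> card V = 2 ^ (m - i) \<and> C \<subseteq> {1..k} \<and> card C \<le> i * num_selected k \<and>
    (i > 0 \<longrightarrow> C \<noteq> {}) \<and> (i > 0 \<and> 2 * card V \<le> num_selected k \<longrightarrow> V \<subseteq> C) \<and>
    t \<le> k + (\<Sum>j<i. 3 * 2 ^ (m - j) + 2 ^ (m - Suc j) * (round_size \<epsilon> \<delta> (Suc j) + 1))"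
  using assms(2,3)
proof (induction i arbitrary: V C t)
  case 0
  thus ?case using k by auto
next
  case (Suc i)
  obtain V\<^sub>0 C\<^sub>0 t\<^sub>0 where prev: "(V\<^sub>0, C\<^sub>0, t\<^sub>0) \<in> set_pmf (knockout k v \<epsilon> \<delta> xs i)"
    and step: "(V, C, t) \<in> set_pmf (do {
       A \<leftarrow> pmf_of_set {A. A \<subseteq> V\<^sub>0 \<and> card A = min (num_selected k) (card V\<^sub>0)};
       P \<leftarrow> pmf_of_set (pairings V\<^sub>0);
       let ys = take (round_size \<epsilon> \<delta> (Suc i)) xs;
       return_pmf (pair_winner v ys ` P, C\<^sub>0 \<union> A,
                 t\<^sub>0 + 2 * card V\<^sub>0 + card A + (\<Sum>e\<in>P. scheffe_time ys))})"
    using Suc.prems(2) by (auto simp del: set_pmf_of_set)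
  have V0: "V\<^sub>0 \<subseteq> {1..k}" "card V\<^sub>0 = 2 ^ (m - i)" "C\<^sub>0 \<subseteq> {1..k}" "card C\<^sub>0 \<le> i * num_selected k"
    "t\<^sub>0 \<le> k + (\<Sum>j<i. 3 * 2 ^ (m - j) + 2 ^ (m - Suc j) * (round_size \<epsilon> \<delta> (Suc j) + 1))"
    using Suc.IH[OF _ prev] Suc.prems(1) by auto
  have fin: "finite V\<^sub>0" using V0(1) by (rule finite_subset) simp
  have double: "card V\<^sub>0 = 2 * 2 ^ (m - Suc i)"
    using V0(2) Suc.prems(1) by (metis Suc_diff_Suc Suc_le_lessD power_Suc)
  have ev: "even (card V\<^sub>0)" by (simp add: double)
  define ys where "ys = take (round_size \<epsilon> \<delta> (Suc i)) xs"
  obtain A P where A: "A \<subseteq> V\<^sub>0" "card A = min (num_selected k) (card V\<^sub>0)" and P: "P \<in> pairings V\<^sub>0"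
    and eq: "V = pair_winner v ys ` P" "C = C\<^sub>0 \<union> A"
      "t = t\<^sub>0 + 2 * card V\<^sub>0 + card A + (\<Sum>e\<in>P. scheffe_time ys)"
    using step unfolding set_bind_pmf set_pmf_random_subset[OF fin]
      set_pmf_random_pairing[OF fin ev] Let_def ys_def[symmetric] by auto
  have V: "V \<subseteq> V\<^sub>0" "2 * card V = card V\<^sub>0"
    using winners_of_pairing[OF fin P] by (simp_all add: eq)
  have "k \<ge> 1" by (simp add: k)
  have "card A > 0" using A(2) num_selected_ge_1[OF \<open>k \<ge> 1\<close>] double by simp
  hence "C \<noteq> {}" by (auto simp: eq)
  \<comment> \<open>The round was entered by \<open>2 * card V\<close> candidates; if the subset may
    be that large, it is all of \<open>V\<^sub>0\<close>.\<close>
  moreover have "V \<subseteq> C" if "2 * card V \<le> num_selected k"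
    using that V A card_subset_eq[OF fin A(1)] by (auto simp: eq)
  moreover have "card C \<le> Suc i * num_selected k"
    using card_Un_le[of C\<^sub>0 A] A(2) V0(4) by (simp add: eq)
  moreover have "t \<le> k + (\<Sum>j<Suc i. 3 * 2 ^ (m - j) + 2 ^ (m - Suc j) * (round_size \<epsilon> \<delta> (Suc j) + 1))"
  proof -
    have "card P = 2 ^ (m - Suc i)" using card_pairing(1)[OF fin P] double by simp
    hence "(\<Sum>e\<in>P. scheffe_time ys) \<le> 2 ^ (m - Suc i) * (round_size \<epsilon> \<delta> (Suc i) + 1)"
      by (simp add: scheffe_time_def ys_def)
    moreover have "2 * card V\<^sub>0 + card A \<le> 3 * 2 ^ (m - i)" using A V0(2) by simp
    ultimately show ?thesis using V0(5) by (simp add: eq)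
  qed
  ultimately show ?case using V V0 A double by (auto simp: eq(2))
qed

text \<open>Once an element of \<open>G\<close> is collected, the state can never become lost, so
  \<open>a\<close> has to survive only until then.\<close>

definition lost :: "nat \<Rightarrow> nat set \<Rightarrow> (nat set \<times> nat set \<times> nat) set" where
  "lost a G = {(V, C, t). C \<inter> G = {} \<and> a \<notin> V}"

text \<open>The sample is fixed, so only subsets and pairings are random. A state that is not lost
  has either hit \<open>G\<close> for good or still contains \<open>a\<close>; in the latter case
  \<open>round_loss_prob\<close> bounds the loss in the next round, and these bounds add up.\<close>

lemma knockout_lost_prob:
  fixes v p n \<epsilon> a k
  defines "G \<equiv> {j. l1_dist n p (v j) \<le> 3 * l1_dist n p (v a) + 4 * \<epsilon>}"
  assumes k: "k = 2 ^ m" and "i \<le> m" and a: "a \<in> {1..k}"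
    and supp: "\<And>j. j \<in> {1..k} \<Longrightarrow> set_pmf (v j) \<subseteq> {1..n}" "set_pmf p \<subseteq> {1..n}" and "\<epsilon> \<ge> 0"
  shows "measure_pmf.prob (knockout k v \<epsilon> \<delta> xs i) (lost a G) \<le>
    (\<Sum>j=1..i. 1 / (real (num_selected k) + 1) + 2 ^ j / real k *
       real (card {b \<in> {1..k} - {a}. \<not> accurate v p \<epsilon> (take (round_size \<epsilon> \<delta> j) xs) {a, b}}))"
  using \<open>i \<le> m\<close>
proof (induction i)
  case 0
  show ?case using a by (simp add: lost_def)
next
  case (Suc i)
  define ys where "ys = take (round_size \<epsilon> \<delta> (Suc i)) xs"
  \<comment> \<open>\<open>B\<close> ranges over all candidates, not just over the survivors, which
    depend on the sample; so its expected size can be computed without reference to the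
    knockout.\<close>
  define B where "B = {b \<in> {1..k} - {a}. \<not> accurate v p \<epsilon> ys {a, b}}"
  define r where "r = 1 / (real (num_selected k) + 1) + 2 ^ Suc i / real k * real (card B)"
  have "r \<ge> 0" by (simp add: r_def)
  have aG: "a \<in> G" using \<open>\<epsilon> \<ge> 0\<close> l1_dist_nonneg[of n p "v a"] by (simp add: G_def)
  have "measure_pmf.prob (knockout k v \<epsilon> \<delta> xs (Suc i)) (lost a G) \<le>
        measure_pmf.prob (knockout k v \<epsilon> \<delta> xs i) (lost a G) + r"
    unfolding knockout.simps
  proof (rule measure_bind_pmf_le[OF _ \<open>r \<ge> 0\<close>], clarify)
    fix V C t assume st: "(V, C, t) \<in> set_pmf (knockout k v \<epsilon> \<delta> xs i)" and nl: "(V, C, t) \<notin> lost a G"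
    have V: "V \<subseteq> {1..k}" "card V = 2 ^ (m - i)"
      using knockout_support[OF k _ st] Suc.prems by auto
    have fin: "finite V" using V(1) by (rule finite_subset) simp
    have ev: "even (card V)" using V(2) Suc.prems by simp
    let ?A = "pmf_of_set {A. A \<subseteq> V \<and> card A = min (num_selected k) (card V)}"
    let ?P = "pmf_of_set (pairings V)"
    define f where "f = (\<lambda>A P. (pair_winner v ys ` P, C \<union> A,
       t + 2 * card V + card A + (\<Sum>e\<in>P. scheffe_time ys)))"
    \<comment> \<open>Given \<open>V\<close>, both draws are independent. Drawn as a pair, they make
      the loss a product event.\<close>
    have "measure_pmf.prob (?A \<bind> (\<lambda>A. ?P \<bind> (\<lambda>P. return_pmf (f A P)))) (lost a G) =
          measure_pmf.prob (map_pmf (\<lambda>(A, P). f A P) (pair_pmf ?A ?P)) (lost a G)"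
      by (simp add: pair_pmf_def map_pmf_def bind_assoc_pmf bind_return_pmf)
    also have "\<dots> \<le> r"
    proof (cases "C \<inter> G = {}")
      case False
      have "(\<lambda>(A, P). f A P) -` lost a G = {}" using False by (auto simp: lost_def f_def)
      thus ?thesis using \<open>r \<ge> 0\<close> by simp
    next
      case True
      have aV: "a \<in> V" using nl True by (auto simp: lost_def)
      let ?x = "measure_pmf.prob ?A {A. A \<inter> G = {}}"
      let ?y = "measure_pmf.prob ?P {P. a \<notin> pair_winner v ys ` P}"
      have "(\<lambda>(A, P). f A P) -` lost a G = {A. A \<inter> G = {}} \<times> {P. a \<notin> pair_winner v ys ` P}"
        using True by (auto simp: lost_def f_def)
      hence "measure_pmf.prob (map_pmf (\<lambda>(A, P). f A P) (pair_pmf ?A ?P)) (lost a G) = ?x * ?y"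
        by (simp add: prob_pair_pmf_Times)
      also have "\<dots> \<le> r"
      proof (cases "num_selected k \<le> card V")
        case le: True
        have "?x * ?y \<le> 1 / (real (min (num_selected k) (card V)) + 1) +
            2 * real (card B) / real (card V)"
        proof (rule round_loss_prob[OF fin ev aV aG])
          fix b assume b: "b \<in> V - {a}" "b \<notin> G" "b \<notin> B"
          have "accurate v p \<epsilon> ys {a, b}" using b V(1) by (auto simp: B_def)
          hence "pair_winner v ys {a, b} \<noteq> b"
            using pair_winner_l1_dist[of v a n b p \<epsilon> ys] supp a b V(1) by (auto simp: G_def)
          thus "pair_winner v ys {a, b} = a" using pair_winner_in[of "{a, b}" v ys] b by auto
        qed (auto simp: B_def)
        \<comment> \<open>\<open>card V\<close> is \<open>k\<close> divided by
          \<open>2 ^ i\<close>.\<close>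
        also have "2 * real (card B) / real (card V) = 2 ^ Suc i / real k * real (card B)"
        proof -
          have "2 ^ m = (2::real) ^ i * 2 ^ (m - i)" using Suc.prems by (simp flip: power_add)
          thus ?thesis by (simp add: V(2) k)
        qed
        finally show ?thesis using le by (simp add: r_def)
      next
        case False
        \<comment> \<open>All of \<open>V\<close> is selected, including \<open>a\<close>, so
          \<open>G\<close> cannot be missed.\<close>
        have "set_pmf ?A \<inter> {A. A \<inter> G = {}} = {}"
        proof -
          have "A = V" if "A \<subseteq> V" "card A = min (num_selected k) (card V)" for A
            using that False card_subset_eq[OF fin] by simp
          thus ?thesis using aV aG by (auto simp: set_pmf_random_subset[OF fin])
        qed
        hence "?x = 0" by (simp add: measure_pmf_zero_iff)
        thus ?thesis using \<open>r \<ge> 0\<close> by simp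
      qed
      finally show ?thesis .
    qed
    finally show "measure_pmf.prob (?A \<bind> (\<lambda>A. ?P \<bind> (\<lambda>P.
        let ys = take (round_size \<epsilon> \<delta> (Suc i)) xs in
        return_pmf (pair_winner v ys ` P, C \<union> A,
          t + 2 * card V + card A + (\<Sum>e\<in>P. scheffe_time ys))))) (lost a G) \<le> r"
      by (simp add: f_def ys_def Let_def)
  qed
  also have "\<dots> \<le> (\<Sum>j=1..i. 1 / (real (num_selected k) + 1) + 2 ^ j / real k *
       real (card {b \<in> {1..k} - {a}. \<not> accurate v p \<epsilon> (take (round_size \<epsilon> \<delta> j) xs) {a, b}})) + r"
    using Suc.IH Suc.prems by simp
  finally show ?case by (simp add: r_def B_def ys_def)
qed

section \<open>Failure probability\<close>

lemma num_rounds_power_two: "num_rounds (2 ^ m) = m"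
  by (simp add: num_rounds_def)

lemma round_size_mono:
  assumes "\<delta> > 0" "i \<le> j"
  shows "round_size \<epsilon> \<delta> i \<le> round_size \<epsilon> \<delta> j"
proof -
  have "\<delta> / 4 ^ j \<le> \<delta> / 4 ^ i"
    using assms by (intro divide_left_mono power_increasing) auto
  hence "ln (1 / (\<delta> / 4 ^ i)) \<le> ln (1 / (\<delta> / 4 ^ j))"
    using assms by (intro ln_mono divide_left_mono) auto
  thus ?thesis unfolding round_size_def
    by (intro nat_mono floor_mono divide_right_mono mult_left_mono) auto
qed

lemma card_all_pairs: "finite C \<Longrightarrow> card (all_pairs C) = card C choose 2"
  by (simp add: all_pairs_def n_subsets)

text \<open>The final sample is drawn after \<open>C\<close> is determined, so \<open>C\<close> may
  be fixed and a union bound over its pairs applies. The number of pairs cancels against the one in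
  the sample size.\<close>

lemma final_tests_inaccurate_prob:
  assumes "0 < \<epsilon>" "\<epsilon> \<le> 1" "0 < \<delta>" "\<delta> \<le> 1" "finite C"
  shows "measure_pmf.prob (replicate_pmf (final_size \<epsilon> \<delta> (card C)) p)
           {ys. \<exists>e\<in>all_pairs C. \<not> accurate v p \<epsilon> ys e} \<le> 2 * exp 2 * \<delta>"
proof (cases "card C choose 2 = 0")
  case True
  hence "all_pairs C = {}" by (simp only: card_all_pairs[OF assms(5), symmetric]
      card_0_eq[OF finite_all_pairs[OF assms(5)]])
  thus ?thesis using assms by simp
next
  case False
  let ?M = "replicate_pmf (final_size \<epsilon> \<delta> (card C)) p"
  let ?y = "real (card C choose 2) / \<delta>"
  have "real (card C choose 2) \<ge> 1" using False by linarith
  hence "?y \<ge> 1" using assms by (simp add: field_simps)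
  have "measure_pmf.prob ?M {ys. \<exists>e\<in>all_pairs C. \<not> accurate v p \<epsilon> ys e} =
        measure_pmf.prob ?M (\<Union>e\<in>all_pairs C. {ys. \<not> accurate v p \<epsilon> ys e})"
    by (intro arg_cong[where f="measure_pmf.prob ?M"]) auto
  also have "\<dots> \<le> (\<Sum>e\<in>all_pairs C. measure_pmf.prob ?M {ys. \<not> accurate v p \<epsilon> ys e})"
    by (rule measure_pmf.finite_measure_subadditive_finite) (use finite_all_pairs assms in auto)
  also have "\<dots> \<le> (\<Sum>e\<in>all_pairs C. 2 * exp 2 / ?y)"
    unfolding accurate_def not_le
    by (intro sum_mono sample_fraction_deviation_log_size assms \<open>?y \<ge> 1\<close>) (simp add: final_size_def)
  also have "\<dots> = 2 * exp 2 * \<delta>" using False assms by (simp add: card_all_pairs)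
  finally show ?thesis .
qed

text \<open>The decay \<open>4 ^ j\<close> beats the weight \<open>2 ^ j / k\<close> that round
  \<open>j\<close> has in \<open>knockout_lost_prob\<close>.\<close>

lemma round_test_inaccurate_prob:
  assumes "0 < \<epsilon>" "\<epsilon> \<le> 1" "0 < \<delta>" "\<delta> \<le> 1" "j \<le> m"
  shows "measure_pmf.prob (replicate_pmf (round_size \<epsilon> \<delta> m) p)
           {xs. \<not> accurate v p \<epsilon> (take (round_size \<epsilon> \<delta> j) xs) e} \<le> 2 * exp 2 * \<delta> / 4 ^ j"
proof -
  let ?s = "round_size \<epsilon> \<delta> j"
  have "\<delta> \<le> 4 ^ j" using assms(4) one_le_power[of "4::real" j] by linarith
  hence y: "1 / (\<delta> / 4 ^ j) \<ge> 1" using assms by (simp add: field_simps)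
  have "measure_pmf.prob (replicate_pmf (round_size \<epsilon> \<delta> m) p)
           {xs. \<not> accurate v p \<epsilon> (take ?s xs) e} =
        measure_pmf.prob (map_pmf (take ?s) (replicate_pmf (round_size \<epsilon> \<delta> m) p))
           {ys. \<not> accurate v p \<epsilon> ys e}"
    by (simp add: vimage_def)
  also have "\<dots> = measure_pmf.prob (replicate_pmf ?s p) {ys. \<not> accurate v p \<epsilon> ys e}"
    using assms by (simp add: map_take_replicate_pmf round_size_mono)
  also have "\<dots> \<le> 2 * exp 2 / (1 / (\<delta> / 4 ^ j))"
    unfolding accurate_def not_le
    by (rule sample_fraction_deviation_log_size[OF assms(1,2) y]) (simp add: round_size_def)
  finally show ?thesis by simp
qed

lemma select_hypothesis_support:
  assumes "r \<in> set_pmf (select_hypothesis (2 ^ m) v p \<epsilon> \<delta>)"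
  obtains xs V C t ys where
    "length xs = round_size \<epsilon> \<delta> m"
    "(V, C, t) \<in> set_pmf (knockout (2 ^ m) v \<epsilon> \<delta> xs m)"
    "length ys = final_size \<epsilon> \<delta> (card C)"
    "r = \<lparr>outputs = most_wins v ys C, num_samples = length xs + length ys,
          run_time = length xs + t + length ys + (\<Sum>e\<in>all_pairs C. scheffe_time ys) + card C\<rparr>"
  using assms unfolding select_hypothesis_def num_rounds_power_two
  by (auto simp: set_replicate_pmf)

lemma outputs_nonempty:
  assumes "m > 0" "r \<in> set_pmf (select_hypothesis (2 ^ m) v p \<epsilon> \<delta>)"
  shows "outputs r \<noteq> {}" "outputs r \<subseteq> {1..2 ^ m}"
proof -
  obtain xs V C t ys where st: "(V, C, t) \<in> set_pmf (knockout (2 ^ m) v \<epsilon> \<delta> xs m)"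
    and r: "outputs r = most_wins v ys C"
    using select_hypothesis_support[OF assms(2)] by (metis run.select_convs(1))
  have C: "C \<subseteq> {1..2 ^ m}" "C \<noteq> {}" using knockout_support[OF refl order.refl st] assms(1) by auto
  moreover have "finite C" using C(1) by (rule finite_subset) simp
  ultimately show "outputs r \<noteq> {}" "outputs r \<subseteq> {1..2 ^ m}"
    using most_wins_nonempty[of C v ys] by (auto simp: r) (auto simp: most_wins_def)
qed

text \<open>Sums the losses 1 / (t + 1) over all rounds. The logarithm is absorbed into k^(1/12) by
  1 + x <= e^x at x = ln k / 12; with m / 2 <= ln k this gives 24. The resulting exponent -1/4 is
  that of the lower bound on \<delta>.\<close>

lemma rounds_over_num_selected:
  assumes k: "k = 2 ^ m"
  shows "real m / (real (num_selected k) + 1) \<le> 24 * real k powr (- 1 / 4)"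
proof -
  have kp: "real k > 0" by (simp add: k)
  have lnk: "ln (real k) = real m * ln 2" by (simp add: k ln_realpow)
  have ln2: "1 / 2 \<le> ln (2::real)" using ln2_ge_two_thirds by linarith
  have "real (num_selected k) + 1 \<ge> real k powr (1/3)"
    unfolding num_selected_def using powr_ge_zero[of "real k" "1/3"] by linarith
  hence "real m / (real (num_selected k) + 1) \<le> real m / real k powr (1/3)"
    using kp by (intro divide_left_mono mult_pos_pos) auto
  also have "\<dots> = real m * real k powr (- 1 / 3)" by (simp add: powr_minus_divide)
  also have "\<dots> \<le> (24 * real k powr (1/12)) * real k powr (- 1 / 3)"
  proof (intro mult_right_mono)
    have "real m * (1 / 2) \<le> ln (real k)" unfolding lnk using ln2 by (intro mult_left_mono) auto
    moreover have "1 + ln (real k) / 12 \<le> exp (ln (real k) / 12)" by (rule exp_ge_add_one_self)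
    moreover have "real k powr (1/12) = exp (ln (real k) / 12)" using kp by (simp add: powr_def)
    ultimately show "real m \<le> 24 * real k powr (1/12)" by linarith
  qed simp
  also have "\<dots> = 24 * real k powr (- 1 / 4)" by (simp add: powr_add[symmetric])
  finally show ?thesis .
qed

text \<open>Apply (1 + x / 3)^3 <= e^x at x = ln k / 3: here x / 3 >= m / 18, and 5832 =
  18^3.\<close>

lemma num_rounds_cubed_le:
  assumes k: "k = 2 ^ m"
  shows "real m ^ 3 \<le> 5832 * real k powr (1/3)"
proof -
  have kp: "real k > 0" by (simp add: k)
  have lnk: "ln (real k) = real m * ln 2" by (simp add: k ln_realpow)
  have ln2: "1 / 2 \<le> ln (2::real)" using ln2_ge_two_thirds by linarith
  have "real m / 18 \<le> real m * ln 2 / 9"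
    using mult_left_mono[OF ln2, of "real m"] by simp
  hence "(real m / 18) ^ 3 \<le> (1 + (ln (real k) / 3) / real 3) ^ 3"
    unfolding lnk by (intro power_mono) auto
  also have "\<dots> \<le> exp (ln (real k) / 3)"
    by (intro exp_ge_one_plus_x_over_n_power_n) (auto simp: lnk intro: order.trans[of _ 0])
  finally show ?thesis using kp by (simp add: powr_def power_divide)
qed

text \<open>A collected element of \<open>G\<close> enters the tournament bound, whence 27 = 9 * 3
  and 52 = 9 * 4 + 16. In the probability, 24 stems from the random subsets, and
  \<open>2 * exp 2\<close> each from the round tests and the final tests.\<close>

lemma select_failure_prob:
  assumes k: "k = 2 ^ m" "m \<ge> 3" and \<epsilon>: "0 < \<epsilon>" "\<epsilon> \<le> 1" and \<delta>: "0 < \<delta>" "\<delta> \<le> 1"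
    "real k powr (-1/4) \<le> \<delta>"
    and supp: "\<And>j. j \<in> {1..k} \<Longrightarrow> set_pmf (v j) \<subseteq> {1..n}" "set_pmf p \<subseteq> {1..n}" and a: "a \<in> {1..k}"
  shows "measure_pmf.prob (select_hypothesis k v p \<epsilon> \<delta>)
     {r. \<exists>j\<in>outputs r. l1_dist n p (v j) > 27 * l1_dist n p (v a) + 52 * \<epsilon>}
     \<le> (24 + 4 * exp 2) * \<delta>" (is "measure_pmf.prob _ ?Bad \<le> _")
proof -
  define N where "N = round_size \<epsilon> \<delta> m"
  define G where "G = {j. l1_dist n p (v j) \<le> 3 * l1_dist n p (v a) + 4 * \<epsilon>}"
  define X where "X = replicate_pmf N p"
  define \<beta> where "\<beta> = 2 * exp 2 * \<delta>"
  define q where "q = 1 / (real (num_selected k) + 1)"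
  define c where "c = (\<lambda>xs j. real (card {b \<in> {1..k} - {a}. \<not> accurate v p \<epsilon> (take (round_size \<epsilon> \<delta> j) xs) {a, b}}))"
  define inner where "inner = (\<lambda>xs. do {
      (V, C, t) \<leftarrow> knockout k v \<epsilon> \<delta> xs m;
      ys \<leftarrow> replicate_pmf (final_size \<epsilon> \<delta> (card C)) p;
      return_pmf \<lparr>outputs = most_wins v ys C, num_samples = length xs + length ys,
        run_time = length xs + t + length ys + (\<Sum>e\<in>all_pairs C. scheffe_time ys) + card C\<rparr>})"
  have sel: "select_hypothesis k v p \<epsilon> \<delta> = X \<bind> inner"
    by (simp add: select_hypothesis_def X_def N_def inner_def k num_rounds_power_two)
  have "\<beta> \<ge> 0" using \<delta> by (simp add: \<beta>_def)
  have kpos: "k \<ge> 1" by (simp add: k)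
  have aG: "a \<in> G" using \<epsilon> l1_dist_nonneg[of n p "v a"] by (simp add: G_def)
  \<comment> \<open>As \<open>k \<ge> 8\<close>, the last round, entered by two candidates, collects
    both. A surviving \<open>a\<close> is thus in \<open>C\<close>, so in a state that is not lost
    \<open>C\<close> meets \<open>G\<close>.\<close>
  have sel2: "num_selected k \<ge> 2"
  proof -
    have "(2::nat) ^ 3 \<le> k" unfolding k(1) by (intro power_increasing k) auto
    hence "(8::real) powr (1/3) \<le> real k powr (1/3)" by (intro powr_mono2) auto
    moreover have "(8::real) powr (1/3) = 2"
    proof -
      have "(8::real) = 2 powr 3" by simp
      thus ?thesis by (simp only: powr_powr) simp
    qed
    ultimately show ?thesis unfolding num_selected_def by (simp add: le_nat_iff le_floor_iff)
  qed
  have inner_le: "measure_pmf.prob (inner xs) ?Bad \<le> (\<Sum>j=1..m. q + 2 ^ j / real k * c xs j) + \<beta>" for xs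
  proof -
    have "measure_pmf.prob (inner xs) ?Bad \<le> measure_pmf.prob (knockout k v \<epsilon> \<delta> xs m) (lost a G) + \<beta>"
      unfolding inner_def
    proof (rule measure_bind_pmf_le[OF _ \<open>\<beta> \<ge> 0\<close>], clarify)
      fix V C t assume st: "(V, C, t) \<in> set_pmf (knockout k v \<epsilon> \<delta> xs m)" and nl: "(V, C, t) \<notin> lost a G"
      have inv: "card V = 1" "C \<subseteq> {1..k}" "2 * card V \<le> num_selected k \<Longrightarrow> V \<subseteq> C"
        using knockout_support[OF k(1) order.refl st] k(2) by auto
      have fin: "finite C" using inv(2) by (rule finite_subset) simp
      have "V \<subseteq> C" using inv sel2 by simp
      with nl aG obtain g where g: "g \<in> C" "g \<in> G" by (auto simp: lost_def)
      let ?M = "replicate_pmf (final_size \<epsilon> \<delta> (card C)) p"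
      let ?f = "\<lambda>ys. \<lparr>outputs = most_wins v ys C, num_samples = length xs + length ys,
        run_time = length xs + t + length ys + (\<Sum>e\<in>all_pairs C. scheffe_time ys) + card C\<rparr>"
      have "measure_pmf.prob (map_pmf ?f ?M) ?Bad \<le>
            measure_pmf.prob ?M {ys. \<exists>e\<in>all_pairs C. \<not> accurate v p \<epsilon> ys e}"
        unfolding measure_map_pmf
      proof (rule measure_pmf.finite_measure_mono)
        show "?f -` ?Bad \<subseteq> {ys. \<exists>e\<in>all_pairs C. \<not> accurate v p \<epsilon> ys e}"
        proof (rule subsetI, rule ccontr)
          fix ys assume bad: "ys \<in> ?f -` ?Bad" and acc: "ys \<notin> {ys. \<exists>e\<in>all_pairs C. \<not> accurate v p \<epsilon> ys e}"
          obtain j where j: "j \<in> most_wins v ys C" "l1_dist n p (v j) > 27 * l1_dist n p (v a) + 52 * \<epsilon>"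
            using bad by auto
          have "l1_dist n p (v j) \<le> 9 * l1_dist n p (v g) + 16 * \<epsilon>"
            by (rule most_wins_l1_dist[OF _ supp(2) fin g(1) _ j(1)]) (use supp(1)[OF subsetD[OF inv(2)]] acc \<epsilon> in auto)
          with j(2) g(2) show False by (simp add: G_def)
        qed
      qed simp
      also have "\<dots> \<le> \<beta>"
        unfolding \<beta>_def by (rule final_tests_inaccurate_prob) (use \<epsilon> \<delta> fin in auto)
      finally show "measure_pmf.prob (?M \<bind> (\<lambda>ys. return_pmf (?f ys))) ?Bad \<le> \<beta>"
        by (simp add: map_pmf_def)
    qed
    also have "measure_pmf.prob (knockout k v \<epsilon> \<delta> xs m) (lost a G) \<le> (\<Sum>j=1..m. q + 2 ^ j / real k * c xs j)"
      unfolding q_def c_def G_def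
      by (rule knockout_lost_prob[OF k(1) order.refl a supp]) (use \<epsilon> in auto)
    finally show ?thesis by simp
  qed
  have int_c: "integrable (measure_pmf X) (\<lambda>xs. c xs j)" for j
  proof (rule measure_pmf.integrable_const_bound[where B="real k"])
    have "card {b \<in> {1..k} - {a}. R b} \<le> card {1..k}" for R
      by (intro card_mono) auto
    thus "AE xs in measure_pmf X. norm (c xs j) \<le> real k" by (simp add: c_def)
  qed simp
  have exp_c: "measure_pmf.expectation X (\<lambda>xs. c xs j) \<le> real k * (\<beta> / 4 ^ j)" if "j \<le> m" for j
  proof -
    have "measure_pmf.expectation X (\<lambda>xs. c xs j) =
       (\<Sum>b\<in>{1..k} - {a}. measure_pmf.prob X {xs. \<not> accurate v p \<epsilon> (take (round_size \<epsilon> \<delta> j) xs) {a, b}})"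
      unfolding c_def by (rule expectation_card_filter) simp
    also have "\<dots> \<le> (\<Sum>b\<in>{1..k} - {a}. \<beta> / 4 ^ j)"
      unfolding X_def N_def \<beta>_def using \<epsilon> \<delta> that by (intro sum_mono round_test_inaccurate_prob) auto
    also have "\<dots> = real (card ({1..k} - {a})) * (\<beta> / 4 ^ j)" by (rule sum_constant)
    also have "\<dots> \<le> real k * (\<beta> / 4 ^ j)"
      using a \<open>\<beta> \<ge> 0\<close> by (intro mult_right_mono) auto
    finally show ?thesis .
  qed
  have "measure_pmf.prob (select_hypothesis k v p \<epsilon> \<delta>) ?Bad =
        measure_pmf.expectation X (\<lambda>xs. measure_pmf.prob (inner xs) ?Bad)"
    by (simp add: sel measure_bind_pmf_expectation)
  also have "\<dots> \<le> measure_pmf.expectation X (\<lambda>xs. (\<Sum>j=1..m. q + 2 ^ j / real k * c xs j) + \<beta>)"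
    using int_c inner_le
    by (intro integral_mono measure_pmf.integrable_const_bound[where B=1 and f="\<lambda>xs. measure_pmf.prob (inner xs) ?Bad"])
       auto
  also have "\<dots> = (\<Sum>j=1..m. q + 2 ^ j / real k * measure_pmf.expectation X (\<lambda>xs. c xs j)) + \<beta>"
    using int_c by simp
  also have "\<dots> \<le> (\<Sum>j=1..m. q + 2 ^ j / real k * (real k * (\<beta> / 4 ^ j))) + \<beta>"
    by (intro add_right_mono sum_mono add_left_mono mult_left_mono exp_c) auto
  \<comment> \<open>The number of candidates cancels, and 2^j / 4^j leaves a geometric
    series.\<close>
  also have "\<dots> = (\<Sum>j=1..m. q + \<beta> * (1 / 2) ^ j) + \<beta>"
  proof -
    have "2 ^ j / real k * (real k * (\<beta> / 4 ^ j)) = \<beta> * (1 / 2) ^ j" for j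
    proof -
      have "(4::real) ^ j = 2 ^ j * 2 ^ j" by (simp flip: power_mult_distrib)
      thus ?thesis using kpos by (simp add: field_simps)
    qed
    thus ?thesis by simp
  qed
  also have "\<dots> = real m * q + \<beta> * (\<Sum>j=1..m. (1 / 2) ^ j) + \<beta>"
    by (simp add: sum.distrib sum_distrib_left)
  also have "(\<Sum>j=1..m. (1 / 2 :: real) ^ j) = 1 - (1 / 2) ^ m"
    by (induction m) auto
  also have "real m * q + \<beta> * (1 - (1 / 2) ^ m) + \<beta> \<le> 24 * \<delta> + \<beta> * 1 + \<beta>"
  proof (intro add_mono mult_left_mono)
    show "real m * q \<le> 24 * \<delta>"
      using rounds_over_num_selected[OF k(1)] \<delta>(3) by (simp add: q_def)
  qed (use \<open>\<beta> \<ge> 0\<close> in auto)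
  finally show ?thesis by (simp add: \<beta>_def algebra_simps)
qed

text \<open>For k <= 4 the lower bound on \<delta> forces \<delta> >= 1/2; then, as for \<delta> >
  1, the asserted probability is at most 0. For \<epsilon> > 1 the term 52 * \<epsilon> exceeds
  every distance. \<open>select_failure_prob\<close> covers the rest.\<close>

lemma selection_success_prob:
  assumes inp: "selection_input n k v p \<epsilon> \<delta>"
  shows "measure_pmf.prob (select_hypothesis k v p \<epsilon> \<delta>)
     {r. outputs r \<noteq> {} \<and> (\<forall>j\<in>outputs r. l1_dist n p (v j) \<le>
           27 * Min ((\<lambda>i. l1_dist n p (v i)) ` {1..k}) + 52 * \<epsilon>)}
     \<ge> 1 - (24 + 4 * exp 2) * \<delta>" (is "measure_pmf.prob ?M ?Good \<ge> _")
proof -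
  obtain m where k: "k = 2 ^ m" and supp: "\<And>j. j \<in> {1..k} \<Longrightarrow> set_pmf (v j) \<subseteq> {1..n}" "set_pmf p \<subseteq> {1..n}"
    and "\<epsilon> > 0" and \<delta>: "real k powr (-1/4) \<le> \<delta>"
    using inp by (auto simp: selection_input_def)
  have \<delta>0: "\<delta> > 0" using \<delta> k by (smt (verit) powr_gt_zero of_nat_0_less_iff zero_less_power pos2)
  define d where "d = (\<lambda>i. l1_dist n p (v i))"
  have "Min (d ` {1..k}) \<in> d ` {1..k}" using k by (intro Min_in) auto
  then obtain a where a: "a \<in> {1..k}" "Min (d ` {1..k}) = d a" by auto
  have trivial: "1 - (24 + 4 * exp 2) * \<delta> \<le> measure_pmf.prob ?M ?Good" if "\<delta> \<ge> 1 / 2"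
  proof -
    have "2 * (1 / 2) \<le> (24 + 4 * exp 2) * \<delta>"
      using that by (intro mult_mono) (auto intro: add_increasing2)
    thus ?thesis using measure_nonneg[of "measure_pmf ?M" ?Good] by linarith
  qed
  show ?thesis
  proof (cases "m \<ge> 3 \<and> \<delta> \<le> 1")
    case False
    hence "m \<le> 2 \<or> \<delta> > 1" by auto
    moreover have "\<delta> \<ge> 1 / 2" if "m \<le> 2"
    proof -
      have "k \<le> 2 ^ 2" unfolding k using that by (intro power_increasing) auto
      hence "real k \<le> 2 powr 2" by simp
      hence "(2 powr 2 :: real) powr (-1/4) \<le> real k powr (-1/4)"
        using k by (intro powr_mono2') auto
      moreover have "(2 powr 2 :: real) powr (-1/4) = 2 powr (-1/2)" by (simp only: powr_powr) simp
      moreover have "(2::real) powr (-1) \<le> 2 powr (-1/2)" by (intro powr_mono) auto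
      moreover have "(2::real) powr (-1) = 1 / 2" by (simp add: powr_minus)
      ultimately show ?thesis using \<delta> by linarith
    qed
    ultimately show ?thesis using trivial by fastforce
  next
    case True
    hence m: "m \<ge> 3" "\<delta> \<le> 1" by auto
    let ?Bad = "{r. \<exists>j\<in>outputs r. l1_dist n p (v j) > 27 * d a + 52 * \<epsilon>}"
    have ne: "outputs r \<noteq> {}" "outputs r \<subseteq> {1..k}" if "r \<in> set_pmf ?M" for r
      using outputs_nonempty[of m r v p \<epsilon> \<delta>] that m by (auto simp: k)
    have "measure_pmf.prob ?M ?Bad \<le> (24 + 4 * exp 2) * \<delta>"
    proof (cases "\<epsilon> \<le> 1")
      case True
      thus ?thesis unfolding d_def
        by (intro select_failure_prob[OF k m(1) \<open>\<epsilon> > 0\<close> _ \<delta>0 m(2) \<delta> supp a(1)]) auto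
    next
      case False
      have "l1_dist n p (v j) \<le> 27 * d a + 52 * \<epsilon>" if "j \<in> {1..k}" for j
        using l1_dist_le_2[OF supp(2) supp(1)[OF that]] l1_dist_nonneg[of n p "v a"] False
        by (simp add: d_def)
      hence "set_pmf ?M \<inter> ?Bad = {}" using ne by (fastforce simp: not_less)
      hence "measure_pmf.prob ?M ?Bad = 0" by (simp add: measure_pmf_zero_iff)
      thus ?thesis using \<delta>0 by simp
    qed
    moreover have "measure_pmf.prob ?M (- ?Bad) = 1 - measure_pmf.prob ?M ?Bad"
      using measure_pmf.prob_compl[of ?Bad ?M] by (simp add: Compl_eq_Diff_UNIV)
    moreover have "measure_pmf.prob ?M (- ?Bad) \<le> measure_pmf.prob ?M ?Good"
      by (rule measure_pmf.finite_measure_mono_AE)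
         (use ne a(2) in \<open>auto simp: AE_measure_pmf_iff not_less d_def\<close>)
    ultimately show ?thesis by linarith
  qed
qed

section \<open>Samples and running time\<close>

lemma round_size_le:
  assumes "0 < \<delta>" "\<delta> \<le> 1" "\<epsilon> > 0"
  shows "real (round_size \<epsilon> \<delta> i) \<le> 10 * (real i * (2 * ln 2) + ln (1 / \<delta>)) / \<epsilon>\<^sup>2"
proof -
  have "ln (4::real) = 2 * ln 2" using ln_realpow[of "2::real" 2] by simp
  hence "ln (1 / (\<delta> / 4 ^ i)) = real i * (2 * ln 2) + ln (1 / \<delta>)"
    using assms by (simp add: ln_div ln_realpow)
  \<comment> \<open>Truncation to a natural number lies below its argument only for nonnegative
    arguments.\<close>
  moreover have "ln (1 / \<delta>) \<ge> 0" using assms by simp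
  ultimately have "10 * ln (1 / (\<delta> / 4 ^ i)) / \<epsilon>\<^sup>2 \<ge> 0" by simp
  hence "real (round_size \<epsilon> \<delta> i) \<le> 10 * ln (1 / (\<delta> / 4 ^ i)) / \<epsilon>\<^sup>2"
    unfolding round_size_def by linarith
  thus ?thesis by (simp only: \<open>ln (1 / (\<delta> / 4 ^ i)) = _\<close>)
qed

lemma final_size_le:
  assumes "0 < \<delta>" "\<delta> \<le> 1" "\<epsilon> > 0" "c \<le> k" "k \<ge> 1"
  shows "real (final_size \<epsilon> \<delta> c) \<le> 10 * (2 * ln (real k) + ln (1 / \<delta>)) / \<epsilon>\<^sup>2"
proof -
  have nonneg: "ln (1 / \<delta>) \<ge> 0" "ln (real k) \<ge> 0" using assms by auto
  show ?thesis
  proof (cases "c choose 2 = 0")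
    \<comment> \<open>Here \<open>ln 0 = 0\<close> makes the size 0.\<close>
    case True
    thus ?thesis unfolding final_size_def True using nonneg by simp
  next
    case False
    have "c choose 2 \<le> c ^ 2" using False by (intro binomial_le_pow) simp
    also have "\<dots> \<le> k ^ 2" using assms by (intro power_mono) auto
    finally have le: "real (c choose 2) \<le> real k ^ 2" by (simp flip: of_nat_power)
    have ge: "real (c choose 2) \<ge> 1" using False by linarith
    hence pos: "real (c choose 2) > 0" by linarith
    have "ln (real (c choose 2) / \<delta>) = ln (real (c choose 2)) + ln (1 / \<delta>)"
      using pos assms(1) ln_divide_pos[OF pos assms(1)] ln_divide_pos[OF zero_less_one assms(1)] by simp
    also have "ln (real (c choose 2)) \<le> ln (real k ^ 2)" using pos le by (metis ln_mono)
    also have "ln (real k ^ 2) = 2 * ln (real k)" using assms by (simp add: ln_realpow)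
    finally have "ln (real (c choose 2) / \<delta>) \<le> 2 * ln (real k) + ln (1 / \<delta>)" by simp
    hence "10 * ln (real (c choose 2) / \<delta>) / \<epsilon>\<^sup>2 \<le> 10 * (2 * ln (real k) + ln (1 / \<delta>)) / \<epsilon>\<^sup>2"
      by (intro divide_right_mono) auto
    moreover have "0 \<le> 10 * (2 * ln (real k) + ln (1 / \<delta>)) / \<epsilon>\<^sup>2" using nonneg by simp
    ultimately show ?thesis unfolding final_size_def by linarith
  qed
qed

lemma selection_inputE:
  assumes "selection_input n k v p \<epsilon> \<delta>"
  obtains m where "k = 2 ^ m" "\<epsilon> > 0" "\<delta> > 0" "\<delta> < 1 \<Longrightarrow> m \<ge> 1"
    "real k powr (-1/4) \<le> \<delta>"
    "\<And>j. j \<in> {1..k} \<Longrightarrow> set_pmf (v j) \<subseteq> {1..n}" "set_pmf p \<subseteq> {1..n}"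
proof -
  obtain m where k: "k = 2 ^ m" using assms by (auto simp: selection_input_def)
  have \<delta>: "real k powr (-1/4) \<le> \<delta>" using assms by (simp add: selection_input_def)
  have "real k powr (-1/4) > 0" using k by simp
  hence "\<delta> > 0" using \<delta> by linarith
  \<comment> \<open>For k = 1 the lower bound on \<delta> is 1.\<close>
  moreover have "m \<ge> 1" if "\<delta> < 1"
    using that \<delta> k by (cases m) auto
  ultimately show ?thesis using that[OF k] assms \<delta> by (simp add: selection_input_def)
qed

lemma selection_num_samples:
  assumes "selection_input n k v p \<epsilon> \<delta>" "\<delta> \<le> 1" "r \<in> set_pmf (select_hypothesis k v p \<epsilon> \<delta>)"
  shows "real (num_samples r) \<le> 40 * ((ln (real k) + ln (1 / \<delta>)) / \<epsilon>\<^sup>2)"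
proof -
  obtain m where k: "k = 2 ^ m" and "\<epsilon> > 0" "\<delta> > 0" using selection_inputE[OF assms(1)] by metis
  obtain xs V C t ys where xs: "length xs = round_size \<epsilon> \<delta> m"
    and st: "(V, C, t) \<in> set_pmf (knockout (2 ^ m) v \<epsilon> \<delta> xs m)"
    and ys: "length ys = final_size \<epsilon> \<delta> (card C)"
    and r_eq: "r = \<lparr>outputs = most_wins v ys C, num_samples = length xs + length ys,
      run_time = length xs + t + length ys + (\<Sum>e\<in>all_pairs C. scheffe_time ys) + card C\<rparr>"
    by (rule select_hypothesis_support[OF assms(3)[unfolded k]]) (rule that)
  have "C \<subseteq> {1..k}" using knockout_support[OF refl order.refl st] k by auto
  hence C: "card C \<le> k" using card_mono[of "{1..k}" C] by simp
  have lnk: "ln (real k) = real m * ln 2" by (simp add: k ln_realpow)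
  have "k \<ge> 1" by (simp add: k)
  \<comment> \<open>One bound fits both samples: \<open>m\<close> rounds contribute
    \<open>m * (2 * ln 2) = 2 * ln k\<close>, and the tournament has at most \<open>k ^ 2\<close>
    pairs.\<close>
  let ?T = "10 * (2 * ln (real k) + ln (1 / \<delta>)) / \<epsilon>\<^sup>2"
  have "real (length xs) \<le> ?T"
    using round_size_le[OF \<open>\<delta> > 0\<close> assms(2) \<open>\<epsilon> > 0\<close>, of m] by (simp add: xs lnk mult_ac)
  moreover have "real (length ys) \<le> ?T"
    unfolding ys by (rule final_size_le[OF \<open>\<delta> > 0\<close> assms(2) \<open>\<epsilon> > 0\<close> C \<open>k \<ge> 1\<close>])
  ultimately have "real (num_samples r) \<le> ?T + ?T" by (simp only: r_eq run.simps of_nat_add add_mono)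
  also have "\<dots> = (40 * ln (real k) + 20 * ln (1 / \<delta>)) / \<epsilon>\<^sup>2"
    by (simp add: add_divide_distrib[symmetric])
  also have "\<dots> \<le> (40 * ln (real k) + 40 * ln (1 / \<delta>)) / \<epsilon>\<^sup>2"
    using assms(2) \<open>\<delta> > 0\<close> by (intro divide_right_mono) auto
  finally show ?thesis by (simp add: algebra_simps)
qed

section \<open>Running time\<close>

lemma sum_survivors: "(\<Sum>j<m. 2 ^ (m - j)) + 2 = (2 * 2 ^ m :: nat)"
proof (induction m)
  case (Suc m)
  have "(\<Sum>j<Suc m. 2 ^ (Suc m - j)) = 2 * 2 ^ m + (\<Sum>j<m. 2 ^ (m - j) :: nat)"
    by (subst sum.lessThan_Suc_shift) simp
  with Suc show ?case by simp
qed simp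

text \<open>The number of pairs halves while the cost of a test grows linearly with the round, so
  the total is linear in \<open>2 ^ m\<close>.\<close>

lemma sum_weighted_pairs: "(\<Sum>j<m. 2 ^ (m - Suc j) * Suc j) + m + 2 = (2 * 2 ^ m :: nat)"
proof (induction m)
  case (Suc m)
  have "(\<Sum>j<m. 2 ^ (m - Suc j)) + 1 = (2 ^ m :: nat)" for m :: nat
  proof (induction m)
    case (Suc m)
    thus ?case by (subst sum.lessThan_Suc_shift) simp
  qed simp
  from this[of m] have *: "(\<Sum>j<m. 2 ^ (m - Suc j)) + 1 = (2 ^ m :: nat)" .
  have "(\<Sum>j<Suc m. 2 ^ (Suc m - Suc j) * Suc j) =
        2 ^ m + (\<Sum>j<m. 2 ^ (m - Suc j) * Suc j + 2 ^ (m - Suc j))"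
    by (subst sum.lessThan_Suc_shift) (simp add: add_ac)
  also have "\<dots> = 2 ^ m + ((\<Sum>j<m. 2 ^ (m - Suc j) * Suc j) + (\<Sum>j<m. 2 ^ (m - Suc j)))"
    by (simp only: sum.distrib)
  finally show ?case using Suc * by simp
qed simp

text \<open>9 = 1 + 3 * 2 + 2: the initial time, selecting and pairing, and the tests.
  \<open>W \<ge> 1\<close> absorbs the first two.\<close>

lemma knockout_time_le:
  assumes k: "k = 2 ^ m" and st: "(V, C, t) \<in> set_pmf (knockout k v \<epsilon> \<delta> xs m)"
    and W: "W \<ge> 1" "\<And>j. 1 \<le> j \<Longrightarrow> j \<le> m \<Longrightarrow> real (round_size \<epsilon> \<delta> j) + 1 \<le> real j * W"
  shows "real t \<le> 9 * real k * W"
proof -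
  have "t \<le> k + (\<Sum>j<m. 3 * 2 ^ (m - j) + 2 ^ (m - Suc j) * (round_size \<epsilon> \<delta> (Suc j) + 1))"
    using knockout_support[OF k order.refl st] by simp
  hence "real t \<le> real (k + (\<Sum>j<m. 3 * 2 ^ (m - j) + 2 ^ (m - Suc j) * (round_size \<epsilon> \<delta> (Suc j) + 1)))"
    by (simp only: of_nat_le_iff)
  also have "\<dots> = real k + 3 * real (\<Sum>j<m. 2 ^ (m - j)) +
      (\<Sum>j<m. 2 ^ (m - Suc j) * (real (round_size \<epsilon> \<delta> (Suc j)) + 1))"
    by (simp add: sum.distrib sum_distrib_left algebra_simps)
  also have "(\<Sum>j<m. 2 ^ (m - Suc j) * (real (round_size \<epsilon> \<delta> (Suc j)) + 1)) \<le>
      (\<Sum>j<m. 2 ^ (m - Suc j) * (real (Suc j) * W))"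
    by (intro sum_mono mult_left_mono W(2)) auto
  also have "\<dots> = real (\<Sum>j<m. 2 ^ (m - Suc j) * Suc j) * W"
    unfolding of_nat_sum sum_distrib_right by (intro sum.cong) (simp_all add: algebra_simps)
  also have "\<dots> \<le> (2 * real k) * W"
  proof (intro mult_right_mono)
    have "(\<Sum>j<m. 2 ^ (m - Suc j) * Suc j) \<le> 2 * k" using sum_weighted_pairs[of m] k by linarith
    hence "real (\<Sum>j<m. 2 ^ (m - Suc j) * Suc j) \<le> real (2 * k)" by (simp only: of_nat_le_iff)
    thus "real (\<Sum>j<m. 2 ^ (m - Suc j) * Suc j) \<le> 2 * real k" by simp
  qed (use W in auto)
  also have "real (\<Sum>j<m. 2 ^ (m - j)) \<le> 2 * real k"
  proof -
    have "(\<Sum>j<m. 2 ^ (m - j)) \<le> 2 * k" using sum_survivors[of m] k by linarith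
    hence "real (\<Sum>j<m. 2 ^ (m - j)) \<le> real (2 * k)" by (simp only: of_nat_le_iff)
    thus ?thesis by simp
  qed
  finally have "real t \<le> 7 * real k * 1 + 2 * real k * W" by simp
  also have "7 * real k * 1 \<le> 7 * real k * W" using W(1) by (intro mult_left_mono) auto
  finally show ?thesis by (simp add: algebra_simps)
qed

text \<open>The factor \<open>m\<close> stands for the growth of the final sample size. By
  \<open>num_rounds_cubed_le\<close>, (m k^(1/3))^2 m is still linear in \<open>k\<close>.\<close>

lemma card_all_pairs_le:
  assumes k: "k = 2 ^ m" and C: "finite C" "card C \<le> m * num_selected k"
  shows "real (card (all_pairs C)) * real m \<le> 5832 * real k"
proof -
  define h where "h = real k powr (1/3)"
  have h: "h \<ge> 0" "h ^ 3 = real k" using k by (simp_all add: h_def powr_power)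
  have "real (num_selected k) \<le> h"
    unfolding num_selected_def h_def using powr_ge_zero[of "real k" "1/3"] by linarith
  hence "real m * real (num_selected k) \<le> real m * h" by (intro mult_left_mono) auto
  moreover have "real (card C) \<le> real m * real (num_selected k)"
    using C(2) by (simp flip: of_nat_mult)
  ultimately have c: "real (card C) \<le> real m * h" by linarith
  have "card C choose 2 \<le> card C ^ 2"
    by (cases "2 \<le> card C") (auto intro: binomial_le_pow simp: binomial_eq_0)
  hence "real (card (all_pairs C)) \<le> real (card C) ^ 2"
    by (simp add: card_all_pairs[OF C(1)] flip: of_nat_power)
  also have "\<dots> \<le> (real m * h) ^ 2" using c by (intro power_mono) auto
  finally have "real (card (all_pairs C)) * real m \<le> (real m * h) ^ 2 * real m"
    by (intro mult_right_mono) auto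
  also have "\<dots> = real m ^ 3 * h ^ 2" by (simp add: power2_eq_square power3_eq_cube)
  also have "\<dots> \<le> 5832 * h * h ^ 2"
    using num_rounds_cubed_le[OF k] by (intro mult_right_mono) (simp_all add: h_def)
  also have "\<dots> = 5832 * real k" using h(2) by (simp add: power2_eq_square power3_eq_cube)
  finally show ?thesis .
qed

text \<open>The target must dominate costs involving neither \<epsilon> nor \<delta>; the upper
  bounds \<open>\<epsilon>\<^sub>0\<close> and \<open>\<delta>\<^sub>0\<close> keep
  \<open>1 / \<epsilon>\<^sup>2\<close> and \<open>ln (1 / \<delta>)\<close> away from 0. In the
  resulting unit \<open>W\<close>, a test in round \<open>j\<close> costs at most
  \<open>j * W\<close>.\<close>

lemma selection_run_time:
  assumes inp: "selection_input n k v p \<epsilon> \<delta>" and \<epsilon>0: "\<epsilon> \<le> \<epsilon>\<^sub>0" and \<delta>0: "\<delta> \<le> \<delta>\<^sub>0" "\<delta>\<^sub>0 < 1"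
    and r: "r \<in> set_pmf (select_hypothesis k v p \<epsilon> \<delta>)"
  shows "real (run_time r) \<le>
    6000 * (10 * (2 / ln (1 / \<delta>\<^sub>0) + 1) + \<epsilon>\<^sub>0\<^sup>2 / ln (1 / \<delta>\<^sub>0)) * (real k / \<epsilon>\<^sup>2 * ln (1 / \<delta>))"
proof -
  obtain m where k: "k = 2 ^ m" and m: "m \<ge> 1" and "\<epsilon> > 0" "\<delta> > 0"
    using selection_inputE[OF inp] \<delta>0 by (metis order.strict_trans1)
  define L where "L = ln (1 / \<delta>)"
  define L\<^sub>0 where "L\<^sub>0 = ln (1 / \<delta>\<^sub>0)"
  define Z where "Z = L / \<epsilon>\<^sup>2"
  define W where "W = (10 * (2 / L\<^sub>0 + 1) + \<epsilon>\<^sub>0\<^sup>2 / L\<^sub>0) * Z"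
  have \<delta>: "\<delta> \<le> 1" "\<delta>\<^sub>0 > 0" using \<delta>0 \<open>\<delta> > 0\<close> by linarith+
  have L: "L\<^sub>0 > 0" "L\<^sub>0 \<le> L" unfolding L_def L\<^sub>0_def
    using \<delta> \<delta>0 \<open>\<delta> > 0\<close> by (auto intro!: ln_mono divide_left_mono)
  have inv: "1 / \<epsilon>\<^sup>2 \<le> Z / L\<^sub>0"
    using L \<open>\<epsilon> > 0\<close> by (simp add: Z_def field_simps)
  have one: "1 \<le> \<epsilon>\<^sub>0\<^sup>2 / L\<^sub>0 * Z"
  proof -
    have "\<epsilon>\<^sup>2 \<le> \<epsilon>\<^sub>0\<^sup>2" using \<epsilon>0 \<open>\<epsilon> > 0\<close> by (intro power_mono) auto
    hence "1 \<le> \<epsilon>\<^sub>0\<^sup>2 * (1 / \<epsilon>\<^sup>2)" using \<open>\<epsilon> > 0\<close> by (simp add: field_simps)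
    also have "\<dots> \<le> \<epsilon>\<^sub>0\<^sup>2 * (Z / L\<^sub>0)" using inv by (intro mult_left_mono) auto
    finally show ?thesis by simp
  qed
  have Z: "Z \<ge> 0" using L by (simp add: Z_def)
  have W1: "W \<ge> 1" using one Z L by (simp add: W_def distrib_right add_increasing)
  text \<open>A single bound for all sample sizes, with room for one additional time unit.\<close>
  have size: "10 * (real j * (2 * ln 2) + L) / \<epsilon>\<^sup>2 + 1 \<le> real j * W" if "j \<ge> 1" for j
  proof -
    have j: "1 \<le> real j" using that by simp
    have "real j * (2 * ln 2) \<le> real j * 2"
      using ln_2_less_1 by (intro mult_left_mono) auto
    hence "10 * (real j * (2 * ln 2) + L) / \<epsilon>\<^sup>2 \<le> 10 * (real j * 2 + L) / \<epsilon>\<^sup>2"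
      by (intro divide_right_mono) auto
    also have "\<dots> = 10 * (real j * 2 * (1 / \<epsilon>\<^sup>2) + 1 * Z)"
      by (simp add: Z_def add_divide_distrib)
    also have "\<dots> \<le> 10 * (real j * 2 * (Z / L\<^sub>0) + real j * Z)"
      using inv Z j by (intro mult_left_mono add_mono mult_right_mono) auto
    finally have "10 * (real j * (2 * ln 2) + L) / \<epsilon>\<^sup>2 \<le> real j * (10 * (2 / L\<^sub>0 + 1) * Z)"
      by (simp add: algebra_simps)
    moreover have "1 * 1 \<le> real j * (\<epsilon>\<^sub>0\<^sup>2 / L\<^sub>0 * Z)" using one j by (intro mult_mono) auto
    ultimately show ?thesis by (simp add: W_def algebra_simps)
  qed
  obtain xs V C t ys where xs: "length xs = round_size \<epsilon> \<delta> m"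
    and st: "(V, C, t) \<in> set_pmf (knockout (2 ^ m) v \<epsilon> \<delta> xs m)"
    and ys: "length ys = final_size \<epsilon> \<delta> (card C)"
    and r_eq: "r = \<lparr>outputs = most_wins v ys C, num_samples = length xs + length ys,
      run_time = length xs + t + length ys + (\<Sum>e\<in>all_pairs C. scheffe_time ys) + card C\<rparr>"
    by (rule select_hypothesis_support[OF r[unfolded k]]) (rule that)
  note st = st[folded k]
  have C: "C \<subseteq> {1..k}" "card C \<le> m * num_selected k"
    using knockout_support[OF k order.refl st] by auto
  have fin: "finite C" using C(1) by (rule finite_subset) simp
  have Ck: "card C \<le> k" using card_mono[OF _ C(1)] by simp
  have "k \<ge> 1" by (simp add: k)
  have lnk: "ln (real k) = real m * ln 2" by (simp add: k ln_realpow)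
  have mk: "real m * W \<le> real k * W"
  proof (intro mult_right_mono)
    have "m \<le> k" using less_exp[of m] by (simp add: k)
    thus "real m \<le> real k" by simp
  qed (use W1 in auto)
  have rs: "real (round_size \<epsilon> \<delta> j) + 1 \<le> real j * W" if "j \<ge> 1" for j
    using round_size_le[OF \<open>\<delta> > 0\<close> \<delta>(1) \<open>\<epsilon> > 0\<close>, of j] size[OF that] by (simp add: L_def)
  have fs: "real (length ys) + 1 \<le> real m * W"
    using final_size_le[OF \<open>\<delta> > 0\<close> \<delta>(1) \<open>\<epsilon> > 0\<close> Ck \<open>k \<ge> 1\<close>] size[OF m]
    by (simp add: L_def ys lnk mult_ac)
  have "real (card (all_pairs C)) * (real (length ys) + 1) \<le> real (card (all_pairs C)) * (real m * W)"
    using fs by (intro mult_left_mono) auto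
  also have "\<dots> = (real (card (all_pairs C)) * real m) * W" by simp
  also have "\<dots> \<le> 5832 * real k * W"
    using card_all_pairs_le[OF k fin C(2)] W1 by (intro mult_right_mono) auto
  finally have tests: "real (card (all_pairs C)) * (real (length ys) + 1) \<le> 5832 * real k * W" .
  have "real (card C) * 1 \<le> real k * W" using Ck W1 by (intro mult_mono) auto
  moreover have "real (length xs) \<le> real k * W" using rs[OF m] mk xs by simp
  moreover have "real t \<le> 9 * real k * W" by (rule knockout_time_le[OF k st W1 rs])
  moreover have "real (run_time r) = real (length xs) + real t + real (length ys) +
      real (card (all_pairs C)) * (real (length ys) + 1) + real (card C)"
    by (simp add: r_eq scheffe_time_def algebra_simps)
  \<comment> \<open>5844 = 5832 + 9 + 3: the final tests, the knockout, and one each for the two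
    samples and the collected set.\<close>
  ultimately have "real (run_time r) \<le> 5844 * real k * W" using tests fs mk by simp
  also have "\<dots> \<le> 6000 * real k * W" using W1 by (intro mult_right_mono) auto
  finally show ?thesis by (simp add: W_def Z_def L_def L\<^sub>0_def mult_ac)
qed

theorem theorem4p1:
  shows "(\<exists>c\<^sub>1 c\<^sub>2 c\<^sub>3 :: real.
           \<forall>(n :: nat) (k :: nat) (v :: nat \<Rightarrow> nat pmf) (p :: nat pmf) (\<epsilon> :: real) (\<delta> :: real).
             selection_input n k v p \<epsilon> \<delta> \<longrightarrow>
               measure_pmf.prob (select_hypothesis k v p \<epsilon> \<delta>)
                 {r. outputs r \<noteq> {} \<and>
                     (\<forall>j\<in>outputs r. l1_dist n p (v j) \<le>
                        27 * Min ((\<lambda>i. l1_dist n p (v i)) ` {1..k}) + c\<^sub>1 * \<epsilon>)}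
                 \<ge> 1 - c\<^sub>2 * \<delta> \<and>
               (\<delta> \<le> 1 \<longrightarrow>
                 (\<forall>r\<in>set_pmf (select_hypothesis k v p \<epsilon> \<delta>).
                    real (num_samples r) \<le> c\<^sub>3 * ((ln (real k) + ln (1 / \<delta>)) / \<epsilon>\<^sup>2)))) \<and>
         (\<forall>(\<epsilon>\<^sub>0 :: real) (\<delta>\<^sub>0 :: real). \<delta>\<^sub>0 < 1 \<longrightarrow>
           (\<exists>c :: real.
             \<forall>(n :: nat) (k :: nat) (v :: nat \<Rightarrow> nat pmf) (p :: nat pmf) (\<epsilon> :: real) (\<delta> :: real).
               selection_input n k v p \<epsilon> \<delta> \<and> \<epsilon> \<le> \<epsilon>\<^sub>0 \<and> \<delta> \<le> \<delta>\<^sub>0 \<longrightarrow>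
                 (\<forall>r\<in>set_pmf (select_hypothesis k v p \<epsilon> \<delta>).
                    real (run_time r) \<le> c * (real k / \<epsilon>\<^sup>2 * ln (1 / \<delta>)))))"
  apply (rule conjI)
   apply (rule exI[of _ 52])
   apply (rule exI[of _ "24 + 4 * exp 2"])
   apply (rule exI[of _ 40])
   apply (intro allI impI)
   apply (intro conjI impI ballI)
    apply (erule selection_success_prob)
   apply (erule (2) selection_num_samples)
  \<comment> \<open>The constant depends on \<open>\<epsilon>\<^sub>0\<close> and
    \<open>\<delta>\<^sub>0\<close> only; it is the one of
    \<open>selection_run_time\<close>.\<close>
  apply (intro allI impI exI ballI)
  apply (elim conjE)
  apply (rule selection_run_time; assumption)
  done

end
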